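(* There is no dynamic program in binary $\mathrm{DynProp}^*$ that maintains the dynamic $s$-$t$-reachability query. That is, the dynamic $s$-$t$-reachability query is not in binary $\mathrm{DynProp}^*$.
   Context: Schemas consist of relation symbols (with arities) and constant symbols; a database over a schema with a finite domain $D$ interprets each relation symbol as a relation over $D$ of the right arity and each constant symbol as an element of $D$. A dynamic schema is a triple $(\tau_{in},\tau_{aux},\tau_{bi})$ of relational schemas (input, auxiliary, built-in); let $\tau=\tau_{in}\cup\tau_{aux}\cup\tau_{bi}$. The abstract modifications are $\mathrm{ins}_S,\mathrm{del}_S$ for $S\in\tau_{in}$; a concrete modification $\mathrm{ins}_S(\vec a)$ (resp. $\mathrm{del}_S(\vec a)$), for a tuple $\vec a$ over the domain, adds $\vec a$ to (resp. removes it from) $S$; constants are never modified. An update program contains, for every $R\in\tau_{aux}$ and every abstract modification $\delta$ of some $S\in\tau_{in}$, a first-order formula $\varphi^R_\delta(\vec x;\vec y)$ over $\tau$, with $|\vec x|$ the arity of $S$ and $|\vec y|$ the arity of $R$. A state is $(D,\mathcal I,\mathcal A,\mathcal B)$ with an input database $\mathcal I$, auxiliary database $\mathcal A$ and built-in database $\mathcal B$. Applying $\delta(\vec a)$ yields the state $(D,\delta(\mathcal I),\mathcal A',\mathcal B)$ where $R^{\mathcal A'}=\{\vec b : \text{the old state satisfies }\varphi^R_\delta(\vec a;\vec b)\}$; sequences of modifications are applied one after another. A dynamic program is a triple $(P,\mathrm{Init},Q)$ where $P$ is an update program, $\mathrm{Init}=(\mathrm{Init}_{aux},\mathrm{Init}_{bi})$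 with $\mathrm{Init}_{aux}$ an arbitrary map from $\tau_{in}$-databases to $\tau_{aux}$-databases over the same domain and $\mathrm{Init}_{bi}$ an arbitrary map from domains to $\tau_{bi}$-databases, and $Q\in\tau_{aux}$ is a designated query symbol. It maintains the dynamic version of a query $\mathcal Q$ if for every input database $\mathcal D$ with domain $D$ and every finite sequence $\alpha$ of concrete modifications, $\mathcal Q(\alpha(\mathcal D))$ equals the relation $Q$ in the state obtained by applying $\alpha$ to $(D,\mathcal D,\mathrm{Init}_{aux}(\mathcal D),\mathrm{Init}_{bi}(D))$. $\mathrm{DynProp}^*$ is the class of dynamic queries maintainable by such programs whose update formulas are quantifier-free (built-in relations of arbitrary arity allowed). The program is binary if all auxiliary relation symbols have arity at most $2$ (no restriction on built-in arities). An $s$-$t$-graph is a structure over the schema with one binary relation symbol $E$ (edges) and two constant symbols $s,t$; the $s$-$t$-reachability query is the Boolean query that is true iff there is a directed path from $s$ to $t$. *)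

theory Defs
  imports Main
begin

record ('r, 'c) schema =
  rel_syms :: "'r set"
  arity :: "'r \<Rightarrow> nat"
  const_syms :: "'c set"

definition finite_schema :: "('r, 'c) schema \<Rightarrow> bool" where
  "finite_schema \<tau> \<longleftrightarrow> finite (rel_syms \<tau>) \<and> finite (const_syms \<tau>)"

record ('r, 'c, 'd) database =
  rel_val :: "'r \<Rightarrow> 'd list set"
  const_val :: "'c \<Rightarrow> 'd"

definition tuples :: "'d set \<Rightarrow> nat \<Rightarrow> 'd list set" where
  "tuples D n = {xs. length xs = n \<and> set xs \<subseteq> D}"

text \<open>The values outside the schema are fixed, so that a database carries no information beyond
  the interpretation of the symbols of its schema.\<close>

definition is_database :: "('r, 'c) schema \<Rightarrow> 'd set \<Rightarrow> ('r, 'c, 'd) database \<Rightarrow> bool" where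
  "is_database \<tau> D I \<longleftrightarrow>
     finite D \<and> D \<noteq> {} \<and>
     (\<forall>R. if R \<in> rel_syms \<tau> then rel_val I R \<subseteq> tuples D (arity \<tau> R) else rel_val I R = {}) \<and>
     (\<forall>c. if c \<in> const_syms \<tau> then const_val I c \<in> D else const_val I c = undefined)"

text \<open>The tags make the union of the input, auxiliary and built-in schema a disjoint one.\<close>

datatype ('i, 'a, 'b) tagged = In 'i | Aux 'a | Bi 'b

definition union_schema ::
  "('ir, 'ic) schema \<Rightarrow> ('ar, 'ac) schema \<Rightarrow> ('br, 'bc) schema \<Rightarrow>
   (('ir, 'ar, 'br) tagged, ('ic, 'ac, 'bc) tagged) schema" where
  "union_schema \<tau>i \<tau>a \<tau>b =
     \<lparr>rel_syms = In ` rel_syms \<tau>i \<union> Aux ` rel_syms \<tau>a \<union> Bi ` rel_syms \<tau>b,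
      arity = case_tagged (arity \<tau>i) (arity \<tau>a) (arity \<tau>b),
      const_syms = In ` const_syms \<tau>i \<union> Aux ` const_syms \<tau>a \<union> Bi ` const_syms \<tau>b\<rparr>"

definition union_database ::
  "('ir, 'ic, 'd) database \<Rightarrow> ('ar, 'ac, 'd) database \<Rightarrow> ('br, 'bc, 'd) database \<Rightarrow>
   (('ir, 'ar, 'br) tagged, ('ic, 'ac, 'bc) tagged, 'd) database" where
  "union_database I A B =
     \<lparr>rel_val = case_tagged (rel_val I) (rel_val A) (rel_val B),
      const_val = case_tagged (const_val I) (const_val A) (const_val B)\<rparr>"

datatype 'c fo_term = Var nat | Const 'c

datatype ('r, 'c) fo_formula =
    Falsum
  | Equal "'c fo_term" "'c fo_term"
  | Atom 'r "'c fo_term list"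
  | Neg "('r, 'c) fo_formula"
  | Conj "('r, 'c) fo_formula" "('r, 'c) fo_formula"
  | Disj "('r, 'c) fo_formula" "('r, 'c) fo_formula"
  | Exists nat "('r, 'c) fo_formula"
  | Forall nat "('r, 'c) fo_formula"

fun term_vars :: "'c fo_term \<Rightarrow> nat set" where
  "term_vars (Var i) = {i}"
| "term_vars (Const c) = {}"

fun free_vars :: "('r, 'c) fo_formula \<Rightarrow> nat set" where
  "free_vars Falsum = {}"
| "free_vars (Equal u v) = term_vars u \<union> term_vars v"
| "free_vars (Atom R us) = (\<Union>u \<in> set us. term_vars u)"
| "free_vars (Neg \<phi>) = free_vars \<phi>"
| "free_vars (Conj \<phi> \<psi>) = free_vars \<phi> \<union> free_vars \<psi>"
| "free_vars (Disj \<phi> \<psi>) = free_vars \<phi> \<union> free_vars \<psi>"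
| "free_vars (Exists i \<phi>) = free_vars \<phi> - {i}"
| "free_vars (Forall i \<phi>) = free_vars \<phi> - {i}"

fun term_over :: "('r, 'c) schema \<Rightarrow> 'c fo_term \<Rightarrow> bool" where
  "term_over \<tau> (Var i) \<longleftrightarrow> True"
| "term_over \<tau> (Const c) \<longleftrightarrow> c \<in> const_syms \<tau>"

fun formula_over :: "('r, 'c) schema \<Rightarrow> ('r, 'c) fo_formula \<Rightarrow> bool" where
  "formula_over \<tau> Falsum \<longleftrightarrow> True"
| "formula_over \<tau> (Equal u v) \<longleftrightarrow> term_over \<tau> u \<and> term_over \<tau> v"
| "formula_over \<tau> (Atom R us) \<longleftrightarrow>
     R \<in> rel_syms \<tau> \<and> length us = arity \<tau> R \<and> (\<forall>u \<in> set us. term_over \<tau> u)"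
| "formula_over \<tau> (Neg \<phi>) \<longleftrightarrow> formula_over \<tau> \<phi>"
| "formula_over \<tau> (Conj \<phi> \<psi>) \<longleftrightarrow> formula_over \<tau> \<phi> \<and> formula_over \<tau> \<psi>"
| "formula_over \<tau> (Disj \<phi> \<psi>) \<longleftrightarrow> formula_over \<tau> \<phi> \<and> formula_over \<tau> \<psi>"
| "formula_over \<tau> (Exists i \<phi>) \<longleftrightarrow> formula_over \<tau> \<phi>"
| "formula_over \<tau> (Forall i \<phi>) \<longleftrightarrow> formula_over \<tau> \<phi>"

fun quantifier_free :: "('r, 'c) fo_formula \<Rightarrow> bool" where
  "quantifier_free Falsum \<longleftrightarrow> True"
| "quantifier_free (Equal u v) \<longleftrightarrow> True"
| "quantifier_free (Atom R us) \<longleftrightarrow> True"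
| "quantifier_free (Neg \<phi>) \<longleftrightarrow> quantifier_free \<phi>"
| "quantifier_free (Conj \<phi> \<psi>) \<longleftrightarrow> quantifier_free \<phi> \<and> quantifier_free \<psi>"
| "quantifier_free (Disj \<phi> \<psi>) \<longleftrightarrow> quantifier_free \<phi> \<and> quantifier_free \<psi>"
| "quantifier_free (Exists i \<phi>) \<longleftrightarrow> False"
| "quantifier_free (Forall i \<phi>) \<longleftrightarrow> False"

fun term_val :: "('r, 'c, 'd) database \<Rightarrow> (nat \<Rightarrow> 'd) \<Rightarrow> 'c fo_term \<Rightarrow> 'd" where
  "term_val I \<sigma> (Var i) = \<sigma> i"
| "term_val I \<sigma> (Const c) = const_val I c"

fun sat :: "'d set \<Rightarrow> ('r, 'c, 'd) database \<Rightarrow> (nat \<Rightarrow> 'd) \<Rightarrow> ('r, 'c) fo_formula \<Rightarrow> bool" where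
  "sat D I \<sigma> Falsum \<longleftrightarrow> False"
| "sat D I \<sigma> (Equal u v) \<longleftrightarrow> term_val I \<sigma> u = term_val I \<sigma> v"
| "sat D I \<sigma> (Atom R us) \<longleftrightarrow> map (term_val I \<sigma>) us \<in> rel_val I R"
| "sat D I \<sigma> (Neg \<phi>) \<longleftrightarrow> \<not> sat D I \<sigma> \<phi>"
| "sat D I \<sigma> (Conj \<phi> \<psi>) \<longleftrightarrow> sat D I \<sigma> \<phi> \<and> sat D I \<sigma> \<psi>"
| "sat D I \<sigma> (Disj \<phi> \<psi>) \<longleftrightarrow> sat D I \<sigma> \<phi> \<or> sat D I \<sigma> \<psi>"
| "sat D I \<sigma> (Exists i \<phi>) \<longleftrightarrow> (\<exists>d \<in> D. sat D I (\<sigma>(i := d)) \<phi>)"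
| "sat D I \<sigma> (Forall i \<phi>) \<longleftrightarrow> (\<forall>d \<in> D. sat D I (\<sigma>(i := d)) \<phi>)"

datatype 'r abstract_mod = Ins (mod_sym: 'r) | Del (mod_sym: 'r)

type_synonym ('r, 'd) concrete_mod = "'r abstract_mod \<times> 'd list"

definition is_modification ::
  "('r, 'c) schema \<Rightarrow> 'd set \<Rightarrow> ('r, 'd) concrete_mod \<Rightarrow> bool" where
  "is_modification \<tau> D m \<longleftrightarrow>
     mod_sym (fst m) \<in> rel_syms \<tau> \<and> snd m \<in> tuples D (arity \<tau> (mod_sym (fst m)))"

fun modify :: "('r, 'd) concrete_mod \<Rightarrow> ('r, 'c, 'd) database \<Rightarrow> ('r, 'c, 'd) database" where
  "modify (Ins S, a) I = I\<lparr>rel_val := (rel_val I)(S := rel_val I S \<union> {a})\<rparr>"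
| "modify (Del S, a) I = I\<lparr>rel_val := (rel_val I)(S := rel_val I S - {a})\<rparr>"

record ('ir, 'ic, 'ar, 'ac, 'br, 'bc, 'd) state =
  dom_of :: "'d set"
  in_db :: "('ir, 'ic, 'd) database"
  aux_db :: "('ar, 'ac, 'd) database"
  bi_db :: "('br, 'bc, 'd) database"

text \<open>In an update formula for the auxiliary symbol \<open>R\<close> under a modification of the input symbol
  \<open>S\<close>, the variables \<open>0, \<dots>, ar S - 1\<close> stand for the modified tuple and
  \<open>ar S, \<dots>, ar S + ar R - 1\<close> for the tuple whose membership in \<open>R\<close> is decided.\<close>

record ('ir, 'ic, 'ar, 'ac, 'br, 'bc, 'd) dynamic_program =
  in_schema :: "('ir, 'ic) schema"
  aux_schema :: "('ar, 'ac) schema"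
  bi_schema :: "('br, 'bc) schema"
  update_formula :: "'ar \<Rightarrow> 'ir abstract_mod \<Rightarrow>
    (('ir, 'ar, 'br) tagged, ('ic, 'ac, 'bc) tagged) fo_formula"
  init_aux :: "'d set \<Rightarrow> ('ir, 'ic, 'd) database \<Rightarrow> ('ar, 'ac, 'd) database"
  init_bi :: "'d set \<Rightarrow> ('br, 'bc, 'd) database"
  query_sym :: 'ar

definition full_schema ::
  "('ir, 'ic, 'ar, 'ac, 'br, 'bc, 'd) dynamic_program \<Rightarrow>
   (('ir, 'ar, 'br) tagged, ('ic, 'ac, 'bc) tagged) schema" where
  "full_schema P = union_schema (in_schema P) (aux_schema P) (bi_schema P)"

definition is_dynamic_program ::
  "('ir, 'ic, 'ar, 'ac, 'br, 'bc, 'd) dynamic_program \<Rightarrow> bool" where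
  "is_dynamic_program P \<longleftrightarrow>
     finite_schema (in_schema P) \<and> finite_schema (aux_schema P) \<and> finite_schema (bi_schema P) \<and>
     (\<forall>R \<in> rel_syms (aux_schema P). \<forall>\<delta>. mod_sym \<delta> \<in> rel_syms (in_schema P) \<longrightarrow>
        formula_over (full_schema P) (update_formula P R \<delta>) \<and>
        free_vars (update_formula P R \<delta>)
          \<subseteq> {..< arity (in_schema P) (mod_sym \<delta>) + arity (aux_schema P) R}) \<and>
     (\<forall>D I. is_database (in_schema P) D I \<longrightarrow> is_database (aux_schema P) D (init_aux P D I)) \<and>
     (\<forall>D. finite D \<and> D \<noteq> {} \<longrightarrow> is_database (bi_schema P) D (init_bi P D)) \<and>
     query_sym P \<in> rel_syms (aux_schema P)"

definition is_quantifier_free_program ::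
  "('ir, 'ic, 'ar, 'ac, 'br, 'bc, 'd) dynamic_program \<Rightarrow> bool" where
  "is_quantifier_free_program P \<longleftrightarrow>
     (\<forall>R \<in> rel_syms (aux_schema P). \<forall>\<delta>. mod_sym \<delta> \<in> rel_syms (in_schema P) \<longrightarrow>
        quantifier_free (update_formula P R \<delta>))"

definition is_binary_program ::
  "('ir, 'ic, 'ar, 'ac, 'br, 'bc, 'd) dynamic_program \<Rightarrow> bool" where
  "is_binary_program P \<longleftrightarrow> (\<forall>R \<in> rel_syms (aux_schema P). arity (aux_schema P) R \<le> 2)"

definition initial_state ::
  "('ir, 'ic, 'ar, 'ac, 'br, 'bc, 'd) dynamic_program \<Rightarrow> 'd set \<Rightarrow> ('ir, 'ic, 'd) database \<Rightarrow>
   ('ir, 'ic, 'ar, 'ac, 'br, 'bc, 'd) state" where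
  "initial_state P D I =
     \<lparr>dom_of = D, in_db = I, aux_db = init_aux P D I, bi_db = init_bi P D\<rparr>"

definition updated_aux ::
  "('ir, 'ic, 'ar, 'ac, 'br, 'bc, 'd) dynamic_program \<Rightarrow> ('ir, 'd) concrete_mod \<Rightarrow>
   ('ir, 'ic, 'ar, 'ac, 'br, 'bc, 'd) state \<Rightarrow> ('ar, 'ac, 'd) database" where
  "updated_aux P m s = (aux_db s)\<lparr>rel_val := \<lambda>R.
     if R \<in> rel_syms (aux_schema P) then
       {b \<in> tuples (dom_of s) (arity (aux_schema P) R).
          sat (dom_of s) (union_database (in_db s) (aux_db s) (bi_db s))
            (\<lambda>i. (snd m @ b) ! i) (update_formula P R (fst m))}
     else {}\<rparr>"

definition apply_mod ::
  "('ir, 'ic, 'ar, 'ac, 'br, 'bc, 'd) dynamic_program \<Rightarrow> ('ir, 'd) concrete_mod \<Rightarrow>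
   ('ir, 'ic, 'ar, 'ac, 'br, 'bc, 'd) state \<Rightarrow> ('ir, 'ic, 'ar, 'ac, 'br, 'bc, 'd) state" where
  "apply_mod P m s =
     \<lparr>dom_of = dom_of s, in_db = modify m (in_db s), aux_db = updated_aux P m s, bi_db = bi_db s\<rparr>"

text \<open>A query maps a database and its domain to a relation over the domain; for a Boolean query
  this relation is \<open>{[]}\<close> (true) or \<open>{}\<close> (false).\<close>

type_synonym ('r, 'c, 'd) db_query = "'d set \<Rightarrow> ('r, 'c, 'd) database \<Rightarrow> 'd list set"

definition boolean_query ::
  "('d set \<Rightarrow> ('r, 'c, 'd) database \<Rightarrow> bool) \<Rightarrow> ('r, 'c, 'd) db_query" where
  "boolean_query p D I = (if p D I then {[]} else {})"

definition maintains ::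
  "('ir, 'ic, 'ar, 'ac, 'br, 'bc, 'd) dynamic_program \<Rightarrow> ('ir, 'ic, 'd) db_query \<Rightarrow> bool" where
  "maintains P q \<longleftrightarrow>
     (\<forall>D I ms. is_database (in_schema P) D I \<and>
        (\<forall>m \<in> set ms. is_modification (in_schema P) D m) \<longrightarrow>
        q D (fold modify ms I) =
          rel_val (aux_db (fold (apply_mod P) ms (initial_state P D I))) (query_sym P))"

datatype st_rel = Edge

datatype st_const = Source | Target

definition st_schema :: "(st_rel, st_const) schema" where
  "st_schema = \<lparr>rel_syms = {Edge}, arity = (\<lambda>_. 2), const_syms = {Source, Target}\<rparr>"

definition st_reachable :: "'d set \<Rightarrow> (st_rel, st_const, 'd) database \<Rightarrow> bool" where
  "st_reachable D I \<longleftrightarrow>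
     (const_val I Source, const_val I Target) \<in> {(u, v). [u, v] \<in> rel_val I Edge}\<^sup>*"

definition st_reachability :: "(st_rel, st_const, 'd) db_query" where
  "st_reachability = boolean_query st_reachable"

end

theory Submission
  imports Defs "HOL-Library.Ramsey" "HOL-Library.Sublist"
begin

text \<open>
  Quantifier-free updates are local: if a partial isomorphism between two states contains all
  constants, then modifying corresponding tuples inside its domain preserves it, so both runs give
  the same answer. Start from the empty graph, which fixes the auxiliary constants, and pick by Ramsey's
  theorem a set of elements that is order-homogeneous for the built-in relations. Split it into a
  small set \<open>B\<close> and one node \<open>a\<^sub>Y\<close> for every \<open>Y \<subseteq> B\<close>, and insert the edges \<open>a\<^sub>Y \<rightarrow> y\<close> for
  \<open>y \<in> Y\<close> and \<open>y \<rightarrow> t\<close> for \<open>y \<in> B\<close>. Once the edge \<open>s \<rightarrow> a\<^sub>Y\<close> is inserted and the edges \<open>y \<rightarrow> t\<close>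
  with \<open>y \<in> X\<close> are deleted, \<open>t\<close> is reachable iff \<open>Y\<close> is not contained in \<open>X\<close>.

  Since the auxiliary relations are at most binary, a second use of Ramsey's theorem makes a large
  part \<open>b\<^sub>0 < b\<^sub>1 < \<dots>\<close> of \<open>B\<close> homogeneous for them as well. For \<open>Y\<^sub>i = {b\<^sub>0, \<dots>, b\<^sub>i}\<close> the
  binary types of the pairs \<open>(a\<^sub>Y\<^sub>i, b\<^sub>k)\<close> form a word of length \<open>i + 1\<close> over a finite
  alphabet. Higman's lemma yields \<open>i < j\<close> such that the word of \<open>i\<close> is a subsequence of the word of
  \<open>j\<close>; the embedding is a partial isomorphism that maps \<open>Y\<^sub>i\<close> onto a proper subset of \<open>Y\<^sub>j\<close>.
  Deleting these two sets leads to different answers.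
\<close>

section \<open>Higman's lemma\<close>

definition bad_seq :: "'a set \<Rightarrow> (nat \<Rightarrow> 'a list) \<Rightarrow> bool" where
  "bad_seq S f \<longleftrightarrow> (\<forall>i. set (f i) \<subseteq> S) \<and> (\<forall>i j. i < j \<longrightarrow> \<not> subseq (f i) (f j))"

text \<open>Nash-Williams' minimal bad sequence. Dependent choice yields bad sequences
  \<open>F n\<close> whose \<open>n\<close>-th term is shortest given the earlier ones; the diagonal
  is bad because badness compares only two terms at a time.\<close>

lemma minimal_bad_seq_exists:
  assumes "bad_seq S f"
  obtains g where "bad_seq S g"
    and "\<And>n h. bad_seq S h \<Longrightarrow> (\<forall>i<n. h i = g i) \<Longrightarrow> length (g n) \<le> length (h n)"
proof -
  define P where "P n f \<longleftrightarrow> bad_seq S f \<and>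
      (\<forall>f'. bad_seq S f' \<longrightarrow> (\<forall>i<n. f' i = f i) \<longrightarrow> length (f n) \<le> length (f' n))"
    for n and f :: "nat \<Rightarrow> 'a list"
  have step: "\<exists>f'. P n f' \<and> (\<forall>i<n. f' i = f i)" if bad: "bad_seq S f" for n and f :: "nat \<Rightarrow> 'a list"
  proof -
    obtain f' where "bad_seq S f' \<and> (\<forall>i<n. f' i = f i)"
      and "\<forall>h. bad_seq S h \<and> (\<forall>i<n. h i = f i) \<longrightarrow> length (f' n) \<le> length (h n)"
      using ex_has_least_nat[of "\<lambda>h. bad_seq S h \<and> (\<forall>i<n. h i = f i)" f "\<lambda>h. length (h n)"] bad
      by blast
    then show ?thesis
      by (intro exI[of _ f']) (auto simp: P_def)
  qed
  \<comment> \<open>Agreement is demanded for \<open>i < Suc n\<close>, so position \<open>n\<close>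
    is frozen as soon as it is minimal.\<close>
  have "\<exists>F. \<forall>n. P n (F n) \<and> (\<forall>i<Suc n. F (Suc n) i = F n i)"
  proof (rule dependent_nat_choice)
    show "\<exists>f'. P 0 f'" using step[OF assms] by blast
    show "\<exists>f'. P (Suc n) f' \<and> (\<forall>i<Suc n. f' i = f i)" if "P n f" for f n
      using step[of f "Suc n"] that by (auto simp: P_def)
  qed
  then obtain F where F: "\<And>n. P n (F n)" "\<And>n i. i \<le> n \<Longrightarrow> F (Suc n) i = F n i"
    by (auto simp: less_Suc_eq_le)
  define g where "g n = F n n" for n
  have agree: "F m i = g i" if "i \<le> m" for m i
    using that by (induction m rule: dec_induct) (auto simp: g_def F(2))
  have "bad_seq S g"
    unfolding bad_seq_def
  proof (intro conjI allI impI)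
    show "set (g i) \<subseteq> S" for i
      using F(1)[of i] by (auto simp: P_def bad_seq_def g_def)
    show "\<not> subseq (g i) (g j)" if "i < j" for i j
      using F(1)[of j] that agree[of i j] agree[of j j] unfolding P_def bad_seq_def
      by (metis less_imp_le order_refl)
  qed
  moreover have "length (g n) \<le> length (h n)" if "bad_seq S h" "\<forall>i<n. h i = g i" for n h
  proof -
    have "\<forall>i<n. h i = F n i" using that(2) agree by simp
    then show ?thesis using F(1)[of n] that(1) by (simp add: P_def g_def)
  qed
  ultimately show thesis using that by blast
qed

text \<open>By pigeonhole, infinitely many words of a minimal bad sequence start with the same
  letter. Removing this letter from them and dropping the other words from position
  \<open>r 0\<close> on gives a bad sequence with a shorter word at \<open>r 0\<close>, against
  minimality.\<close>

theorem higman: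
  assumes "finite S"
  shows "\<not> bad_seq S f"
proof
  assume "bad_seq S f"
  then obtain g where bad: "bad_seq S g"
    and minimal: "\<And>n h. bad_seq S h \<Longrightarrow> (\<forall>i<n. h i = g i) \<Longrightarrow> length (g n) \<le> length (h n)"
    using minimal_bad_seq_exists by metis
  have nonempty: "g i \<noteq> []" for i
  proof
    assume "g i = []"
    then have "subseq (g i) (g (Suc i))" by simp
    with bad show False by (auto simp: bad_seq_def)
  qed
  have in_S: "set (g i) \<subseteq> S" for i using bad by (simp add: bad_seq_def)
  have "range (\<lambda>n. hd (g n)) \<subseteq> S"
    using nonempty in_S hd_in_set by blast
  then have "finite (range (\<lambda>n. hd (g n)))" using assms finite_subset by blast
  then obtain n0 where "infinite {n. hd (g n) = hd (g n0)}"
    using pigeonhole_infinite[of "UNIV :: nat set" "\<lambda>n. hd (g n)"] by auto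
  then obtain r :: "nat \<Rightarrow> nat" where r: "strict_mono r" "\<And>k. hd (g (r k)) = hd (g n0)"
    using infinite_enumerate by blast
  define h where "h i = (if i < r 0 then g i else tl (g (r (i - r 0))))" for i
  have r0: "r 0 \<le> r k" for k using r(1) by (simp add: strict_mono_less_eq)
  have "bad_seq S h"
    unfolding bad_seq_def
  proof (intro conjI allI impI notI)
    show "set (h i) \<subseteq> S" for i
      using in_S[of i] in_S[of "r (i - r 0)"] list.set_sel(2)[OF nonempty[of "r (i - r 0)"]]
      by (auto simp: h_def)
    fix i j :: nat assume "i < j" and sub: "subseq (h i) (h j)"
    consider "j < r 0" | "i < r 0" "r 0 \<le> j" | "r 0 \<le> i" by linarith
    then show False
    proof cases
      case 1
      with sub \<open>i < j\<close> bad show False by (auto simp: h_def bad_seq_def)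
    next
      case 2
      let ?m = "r (j - r 0)"
      have "subseq (g i) (hd (g ?m) # tl (g ?m))"
        using sub 2 list_emb_Cons by (simp add: h_def)
      then have "subseq (g i) (g ?m)" using nonempty by simp
      moreover have "i < ?m" using 2 r0 less_le_trans by blast
      ultimately show False using bad by (auto simp: bad_seq_def)
    next
      case 3
      let ?k = "r (i - r 0)" and ?m = "r (j - r 0)"
      \<comment> \<open>The common first letter is put back on both sides.\<close>
      have "subseq (hd (g ?k) # tl (g ?k)) (hd (g ?m) # tl (g ?m))"
        using sub 3 \<open>i < j\<close> r(2) by (simp add: h_def)
      then have "subseq (g ?k) (g ?m)" using nonempty by simp
      moreover have "?k < ?m" using r(1) 3 \<open>i < j\<close> by (simp add: strict_mono_less)
      ultimately show False using bad by (auto simp: bad_seq_def)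
    qed
  qed
  moreover have "\<forall>i<r 0. h i = g i" by (simp add: h_def)
  ultimately have "length (g (r 0)) \<le> length (h (r 0))" using minimal by blast
  then show False using nonempty[of "r 0"] by (cases "g (r 0)") (auto simp: h_def)
qed

text \<open>Koenig's lemma: the prescribed length \<open>Suc i\<close> leaves finitely many
  candidates for word \<open>i\<close>, so finite bad sequences for every \<open>n\<close> would
  have prefixes that merge into an infinite one, against \<open>higman\<close>.\<close>

theorem finite_higman:
  fixes S :: "'a set"
  assumes "finite S"
  shows "\<exists>n. \<forall>w. (\<forall>i\<le>n. length (w i) = Suc i \<and> set (w i) \<subseteq> S)
    \<longrightarrow> (\<exists>i j. i < j \<and> j \<le> n \<and> subseq (w i) (w j))"
proof (rule ccontr)
  assume no_bound: "\<not> ?thesis"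
  define bad where "bad n w \<longleftrightarrow> (\<forall>i\<le>n. length (w i) = Suc i \<and> set (w i) \<subseteq> S) \<and>
      (\<forall>i j. j \<le> n \<longrightarrow> i < j \<longrightarrow> \<not> subseq (w i) (w j))" for n and w :: "nat \<Rightarrow> 'a list"
  have ex_bad: "\<exists>w. bad n w" for n
    using no_bound by (simp add: bad_def)
  \<comment> \<open>The invariant of the construction: the first \<open>m\<close> words continue to
    finite bad sequences of unbounded length. It survives the choice of one more word.\<close>
  define P where "P m f \<longleftrightarrow> (\<forall>k. \<exists>n\<ge>k. \<exists>w. bad n w \<and> (\<forall>i<m. w i = f i))"
    for m and f :: "nat \<Rightarrow> 'a list"
  have "\<exists>F. \<forall>m. P m (F m) \<and> (\<forall>i<m. F (Suc m) i = F m i)"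
  proof (rule dependent_nat_choice)
    show "\<exists>f. P 0 f" using ex_bad by (auto simp: P_def)
  next
    fix f m assume Pf: "P m f"
    let ?X = "{x. set x \<subseteq> S \<and> length x = Suc m}"
    have fin: "finite ?X" using assms by (rule finite_lists_length_eq)
    have "\<exists>x. P (Suc m) (f(m := x))"
    proof (rule ccontr)
      assume "\<not> ?thesis"
      then have "\<forall>x. \<exists>k. \<forall>n\<ge>k. \<forall>w. bad n w \<longrightarrow> \<not> (\<forall>i<Suc m. w i = (f(m := x)) i)"
        by (simp add: P_def)
      then obtain k where
        k: "\<And>x n w. k x \<le> n \<Longrightarrow> bad n w \<Longrightarrow> \<not> (\<forall>i<Suc m. w i = (f(m := x)) i)"
        by metis
      \<comment> \<open>The maximum covers \<open>k x\<close> for all candidates \<open>x\<close>,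
        and also \<open>m\<close>, so that word \<open>m\<close> of the sequence is itself one of
        the candidates.\<close>
      obtain n w where n: "n \<ge> Max (insert m (k ` ?X))" and w: "bad n w" "\<forall>i<m. w i = f i"
        using Pf unfolding P_def by blast
      have "m \<le> n" using n fin by simp
      with w have "w m \<in> ?X" by (auto simp: bad_def)
      then have "k (w m) \<le> n" using n fin by simp
      with k w(1) have "\<not> (\<forall>i<Suc m. w i = (f(m := w m)) i)" by blast
      with w(2) show False by (auto simp: less_Suc_eq)
    qed
    then show "\<exists>f'. P (Suc m) f' \<and> (\<forall>i<m. f' i = f i)" by fastforce
  qed
  then obtain F where F: "\<And>m. P m (F m)" "\<And>m i. i < m \<Longrightarrow> F (Suc m) i = F m i"
    by auto
  define g where "g i = F (Suc i) i" for i
  have "F m i = g i" if "Suc i \<le> m" for m i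
    using that by (induction m rule: dec_induct) (auto simp: g_def F(2))
  then have prefix: "\<exists>n\<ge>j. \<exists>w. bad n w \<and> (\<forall>i\<le>j. w i = g i)" for j
    using F(1)[of "Suc j"] unfolding P_def by (fastforce simp: less_Suc_eq_le)
  have "bad_seq S g"
    unfolding bad_seq_def
  proof (intro conjI allI impI)
    show "set (g i) \<subseteq> S" for i
      using prefix[of i] unfolding bad_def by force
    show "\<not> subseq (g i) (g j)" if "i < j" for i j
      using prefix[of j] that unfolding bad_def by (metis less_imp_le order_refl)
  qed
  with higman[OF assms] show False by blast
qed

text \<open>Turns an embedding of words into a map of positions, from which the partial isomorphism
  is built.\<close>

lemma subseq_index_map:
  assumes "subseq xs ys"
  shows "\<exists>g. strict_mono_on {..<length xs} g \<and> (\<forall>k<length xs. g k < length ys \<and> ys ! g k = xs ! k)"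
  using assms
proof induction
  case (list_emb_Nil ys)
  then show ?case by (auto simp: strict_mono_on_def)
next
  case (list_emb_Cons xs ys y)
  then obtain g where "strict_mono_on {..<length xs} g"
    "\<forall>k<length xs. g k < length ys \<and> ys ! g k = xs ! k" by blast
  then show ?case
    by (intro exI[of _ "\<lambda>k. Suc (g k)"]) (auto simp: strict_mono_on_def)
next
  case (list_emb_Cons2 x y xs ys)
  then obtain g where g: "strict_mono_on {..<length xs} g"
    "\<forall>k<length xs. g k < length ys \<and> ys ! g k = xs ! k" by blast
  then show ?case using list_emb_Cons2(1)
    by (intro exI[of _ "case_nat 0 (\<lambda>k. Suc (g k))"])
      (auto simp: strict_mono_on_def nth_Cons split: nat.splits)
qed

section \<open>Order-homogeneous sequences\<close>

text \<open>A pattern describes a tuple over the constants \<open>\<kappa> c\<close> and the elements \<open>x m\<close> with \<open>m\<close> in the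
  index list \<open>u\<close>: \<open>Inl i\<close> stands for \<open>x (u ! i)\<close> and \<open>Inr c\<close> for \<open>\<kappa> c\<close>.\<close>

definition pattern_val :: "(nat \<Rightarrow> 'd) \<Rightarrow> ('c \<Rightarrow> 'd) \<Rightarrow> nat list \<Rightarrow> nat + 'c \<Rightarrow> 'd" where
  "pattern_val x \<kappa> u = case_sum (\<lambda>i. x (u ! i)) \<kappa>"

definition patterns :: "'c set \<Rightarrow> nat \<Rightarrow> nat \<Rightarrow> (nat + 'c) list set" where
  "patterns Cs l r = {p. set p \<subseteq> Inl ` {..<l} \<union> Inr ` Cs \<and> length p \<le> r}"

text \<open>Known from model theory as order indiscernibility over the constants, here for atomic
  facts about tuples of length at most \<open>r\<close>.\<close>

definition homogeneous ::
  "'q set \<Rightarrow> 'c set \<Rightarrow> nat \<Rightarrow> ('q \<Rightarrow> 'd list \<Rightarrow> bool) \<Rightarrow> ('c \<Rightarrow> 'd) \<Rightarrow> (nat \<Rightarrow> 'd) \<Rightarrow> nat \<Rightarrow> bool" where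
  "homogeneous Qs Cs r P \<kappa> x h \<longleftrightarrow>
     (\<forall>u v q p. strict_sorted u \<longrightarrow> strict_sorted v \<longrightarrow> set u \<subseteq> {..<h} \<longrightarrow> set v \<subseteq> {..<h} \<longrightarrow>
        length u = length v \<longrightarrow> length u \<le> r \<longrightarrow> q \<in> Qs \<longrightarrow> p \<in> patterns Cs (length u) r \<longrightarrow>
        P q (map (pattern_val x \<kappa> u) p) = P q (map (pattern_val x \<kappa> v) p))"

lemma finite_patterns: "finite Cs \<Longrightarrow> finite (patterns Cs l r)"
  unfolding patterns_def by (rule finite_lists_length_le) auto

lemma patterns_mono: "l \<le> l' \<Longrightarrow> patterns Cs l r \<subseteq> patterns Cs l' r"
  by (fastforce simp: patterns_def)

lemma strict_sorted_map:
  "strict_sorted u \<Longrightarrow> strict_mono_on (set u) f \<Longrightarrow> strict_sorted (map f u)"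
  for f :: "nat \<Rightarrow> nat"
  by (induction u) (auto simp: strict_mono_on_def)

text \<open>Ramsey's theorem for \<open>r\<close>-sets, each coloured by the set of pairs of a
  symbol and a pattern that hold on it. \<open>N\<close> comes from the number of colours,
  \<open>h\<close> and \<open>r\<close> alone and is therefore fixed before \<open>P\<close>,
  \<open>\<kappa>\<close> and \<open>x\<close>.\<close>

lemma ramsey_homogeneous:
  fixes Qs :: "'q set" and Cs :: "'c set"
  assumes "finite Qs" "finite Cs"
  shows "\<exists>N :: nat. \<forall>(P :: 'q \<Rightarrow> 'd list \<Rightarrow> bool) \<kappa> x.
    \<exists>\<iota>. strict_mono_on {..<h} \<iota> \<and> \<iota> ` {..<h} \<subseteq> {..<N} \<and> homogeneous Qs Cs r P \<kappa> (x \<circ> \<iota>) h"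
proof -
  let ?X = "Pow (Qs \<times> patterns Cs r r)"
  have "finite ?X" using assms by (simp add: finite_patterns)
  then obtain col where "bij_betw col ?X {0..<card ?X}"
    using ex_bij_betw_finite_nat by blast
  then have inj: "inj_on col ?X" and range: "col ` ?X = {..<card ?X}"
    by (auto simp: bij_betw_def atLeast0LessThan)
  obtain N :: nat where N: "partn_lst {..<N} (replicate (card ?X) (h + r)) r"
    using ramsey_full by blast
  have "\<exists>\<iota>. strict_mono_on {..<h} \<iota> \<and> \<iota> ` {..<h} \<subseteq> {..<N} \<and> homogeneous Qs Cs r P \<kappa> (x \<circ> \<iota>) h"
    for P :: "'q \<Rightarrow> 'd list \<Rightarrow> bool" and \<kappa> x
  proof -
    define T where "T u = {(q, p). q \<in> Qs \<and> p \<in> patterns Cs r r \<and> P q (map (pattern_val x \<kappa> u) p)}"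
      for u
    have T: "T u \<in> ?X" for u by (auto simp: T_def)
    define f where "f F = col (T (sorted_list_of_set F))" for F
    have "f \<in> nsets {..<N} r \<rightarrow> {..<card ?X}"
      using range T by (auto simp: f_def simp del: Pow_iff)
    then obtain i H where i: "i < card ?X" and H: "H \<in> nsets {..<N} (h + r)" and "f ` nsets H r \<subseteq> {i}"
      using partn_lstE[OF N, of f "card ?X"] by (metis length_replicate nth_replicate)
    then have mono: "f F = i" if "F \<in> nsets H r" for F using that by blast
    have fin: "finite H" and card: "card H = h + r" and sub: "H \<subseteq> {..<N}"
      using H by (auto simp: nsets_def)
    define \<iota> where "\<iota> k = sorted_list_of_set H ! k" for k
    have len: "length (sorted_list_of_set H) = h + r" using card by simp
    have \<iota>_mono: "strict_mono_on {..<h + r} \<iota>"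
      using strict_sorted_list_of_set[of H] len
      by (auto simp: strict_mono_on_def \<iota>_def sorted_wrt_iff_nth_less)
    have \<iota>_in: "\<iota> k \<in> H" if "k < h + r" for k
      using that nth_mem[of k "sorted_list_of_set H"] fin len by (simp add: \<iota>_def)
    \<comment> \<open>index lists shorter than \<open>r\<close> are padded with the top \<open>r\<close> indices, which are reserved for this\<close>
    define ext where "ext u = u @ [h..<h + (r - length u)]" for u
    have ext: "f (\<iota> ` set (ext u)) = i \<and> sorted_list_of_set (\<iota> ` set (ext u)) = map \<iota> (ext u)"
      if u: "strict_sorted u" "set u \<subseteq> {..<h}" "length u \<le> r" for u
    proof -
      have se: "set (ext u) \<subseteq> {..<h + r}" using u by (auto simp: ext_def)
      have "strict_sorted (ext u)" using u by (auto simp: ext_def sorted_wrt_append)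
      then have ss: "strict_sorted (map \<iota> (ext u))"
        using strict_sorted_map \<iota>_mono se by (metis monotone_on_subset)
      have "length (map \<iota> (ext u)) = r" using u by (simp add: ext_def)
      moreover have "set (map \<iota> (ext u)) \<subseteq> H" using se \<iota>_in by auto
      moreover have "distinct (map \<iota> (ext u))" using ss strict_sorted_iff by blast
      ultimately have "set (map \<iota> (ext u)) \<in> nsets H r"
        using distinct_card by (fastforce simp: nsets_def)
      moreover have "sorted_list_of_set (set (map \<iota> (ext u))) = map \<iota> (ext u)"
        using ss sorted_list_of_set.idem_if_sorted_distinct strict_sorted_iff by blast
      ultimately show ?thesis using mono by (simp only: set_map)
    qed
    have "homogeneous Qs Cs r P \<kappa> (x \<circ> \<iota>) h"
      unfolding homogeneous_def
    proof (intro allI impI)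
      fix u v q p
      assume u: "strict_sorted u" "set u \<subseteq> {..<h}" "length u \<le> r"
        and v: "strict_sorted v" "set v \<subseteq> {..<h}" and len: "length u = length v"
        and q: "q \<in> Qs" and p: "p \<in> patterns Cs (length u) r"
      have "col (T (map \<iota> (ext u))) = col (T (map \<iota> (ext v)))"
        using ext[OF u] ext[OF v] len u(3) unfolding f_def by metis
      then have "T (map \<iota> (ext u)) = T (map \<iota> (ext v))"
        using inj T by (meson inj_onD)
      moreover have "p \<in> patterns Cs r r" using p patterns_mono[OF u(3)] by blast
      ultimately have "P q (map (pattern_val x \<kappa> (map \<iota> (ext u))) p)
          = P q (map (pattern_val x \<kappa> (map \<iota> (ext v))) p)"
        using q by (auto simp: T_def set_eq_iff)
      \<comment> \<open>Patterns refer only to the first \<open>length u\<close> positions, so the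
        padding leaves the tuple unchanged.\<close>
      moreover have "map (pattern_val x \<kappa> (map \<iota> (ext w))) p = map (pattern_val (x \<circ> \<iota>) \<kappa> w) p"
        if "length w = length u" for w
        using p that by (auto simp: patterns_def pattern_val_def ext_def nth_append)
      ultimately show "P q (map (pattern_val (x \<circ> \<iota>) \<kappa> u) p) = P q (map (pattern_val (x \<circ> \<iota>) \<kappa> v) p)"
        using len by simp
    qed
    moreover have "strict_mono_on {..<h} \<iota>" using \<iota>_mono by (auto simp: strict_mono_on_def)
    moreover have "\<iota> ` {..<h} \<subseteq> {..<N}" 
      using \<iota>_in sub by (meson image_subsetI lessThan_iff subsetD trans_less_add1)
    ultimately show ?thesis by blast
  qed
  then show ?thesis by blast
qed

lemma pattern_of_list:
  assumes "set xs \<subseteq> \<kappa> ` Cs \<union> x ` set u"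
  obtains p where "p \<in> patterns Cs (length u) (length xs)" "xs = map (pattern_val x \<kappa> u) p"
proof -
  have "\<kappa> ` Cs \<union> x ` set u = pattern_val x \<kappa> u ` (Inl ` {..<length u} \<union> Inr ` Cs)"
    by (auto simp: pattern_val_def image_Un image_image set_conv_nth)
  then have "xs \<in> map (pattern_val x \<kappa> u) ` lists (Inl ` {..<length u} \<union> Inr ` Cs)"
    using assms by (metis in_listsI lists_image subset_code(1))
  then show thesis using that by (auto simp: patterns_def lists_eq_set)
qed

lemma map_pattern_val:
  assumes "p \<in> patterns Cs (length u) r" "length v = length u"
    and "\<And>c. c \<in> Cs \<Longrightarrow> \<pi> (\<kappa> c) = \<kappa> c" "\<And>i. i < length u \<Longrightarrow> \<pi> (x (u ! i)) = y (v ! i)"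
  shows "map \<pi> (map (pattern_val x \<kappa> u) p) = map (pattern_val y \<kappa> v) p"
  using assms by (auto simp: patterns_def pattern_val_def)

text \<open>Sorting the indices that occur in \<open>xs\<close> makes it a pattern filled by an
  increasing index list. As \<open>\<gamma>\<close> keeps the list increasing and
  \<open>\<pi>\<close> fixes the constants, homogeneity compares the tuple with its image.\<close>

lemma homogeneous_strict_mono_invariant:
  assumes hom: "homogeneous Qs Cs r P \<kappa> x h"
    and J: "J \<subseteq> {..<h}" "strict_mono_on J \<gamma>" "\<gamma> ` J \<subseteq> {..<h}"
    and \<pi>: "\<And>c. c \<in> Cs \<Longrightarrow> \<pi> (\<kappa> c) = \<kappa> c" "\<And>j. j \<in> J \<Longrightarrow> \<pi> (x j) = x (\<gamma> j)"
    and xs: "set xs \<subseteq> \<kappa> ` Cs \<union> x ` J" "length xs \<le> r" and q: "q \<in> Qs"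
  shows "P q xs \<longleftrightarrow> P q (map \<pi> xs)"
proof -
  \<comment> \<open>One index is picked for each distinct entry of \<open>xs\<close> in the image of
    \<open>J\<close> under \<open>x\<close>; hence there are at most \<open>r\<close> of
    them.\<close>
  obtain J' where J': "J' \<subseteq> J" "inj_on x J'" "set xs \<inter> x ` J = x ` J'"
    by (metis inf_le2 subset_image_inj)
  have fin: "finite J'" using J'(1) J(1) by (metis finite_lessThan finite_subset)
  define u where "u = sorted_list_of_set J'"
  have u: "set u = J'" "strict_sorted u" "length u = card J'"
    using fin by (auto simp: u_def)
  have "card J' \<le> card (set xs)"
    using J' by (metis List.finite_set card_image card_mono inf_le1)
  then have lu: "length u \<le> r" using card_length[of xs] xs(2) u(3) by linarith
  have "set xs \<subseteq> \<kappa> ` Cs \<union> set xs \<inter> x ` J" using xs(1) by blast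
  then have "set xs \<subseteq> \<kappa> ` Cs \<union> x ` set u" unfolding J'(3) u(1) .
  then obtain p where p: "p \<in> patterns Cs (length u) (length xs)" "xs = map (pattern_val x \<kappa> u) p"
    using pattern_of_list[of xs \<kappa> Cs x u] by blast
  have p': "p \<in> patterns Cs (length u) r" using p(1) xs(2) by (auto simp: patterns_def)
  have "map \<pi> xs = map (pattern_val x \<kappa> (map \<gamma> u)) p"
    unfolding p(2)
  proof (rule map_pattern_val[OF p(1)])
    show "\<pi> (x (u ! i)) = x (map \<gamma> u ! i)" if "i < length u" for i
      using \<pi>(2)[of "u ! i"] that nth_mem[OF that] u(1) J'(1) by auto
  qed (use \<pi>(1) in auto)
  moreover have "strict_sorted (map \<gamma> u)"
    using u J' J(2) strict_sorted_map monotone_on_subset by metis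
  moreover have "set u \<subseteq> {..<h}" "set (map \<gamma> u) \<subseteq> {..<h}" using J J' u by auto
  ultimately show ?thesis
    using hom u(2) lu q p' p(2) unfolding homogeneous_def by (metis length_map)
qed

text \<open>The atomic type of the pair over the constants, seen through tuples of length at most 2;
  index \<open>0\<close> stands for \<open>a\<close> and \<open>1\<close> for \<open>d\<close>.
  These types are the letters of the words to which Higman's lemma is applied.\<close>

definition pair_type ::
  "'q set \<Rightarrow> 'c set \<Rightarrow> ('q \<Rightarrow> 'd list \<Rightarrow> bool) \<Rightarrow> ('c \<Rightarrow> 'd) \<Rightarrow> 'd \<Rightarrow> 'd \<Rightarrow> ('q \<times> (nat + 'c) list) set" where
  "pair_type Qs Cs P \<kappa> a d = {(q, p). q \<in> Qs \<and> p \<in> patterns Cs 2 2 \<and>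
     P q (map (pattern_val (\<lambda>m. if m = 0 then a else d) \<kappa> [0, 1]) p)}"

lemma pair_type_in_Pow: "pair_type Qs Cs P \<kappa> a d \<in> Pow (Qs \<times> patterns Cs 2 2)"
  by (auto simp: pair_type_def)

lemma pair_type_eq_invariant:
  assumes eq: "pair_type Qs Cs P \<kappa> a d = pair_type Qs Cs P \<kappa> a' d'"
    and \<pi>: "\<And>c. c \<in> Cs \<Longrightarrow> \<pi> (\<kappa> c) = \<kappa> c" "\<pi> a = a'" "\<pi> d = d'"
    and xs: "set xs \<subseteq> \<kappa> ` Cs \<union> {a, d}" "length xs \<le> 2" and q: "q \<in> Qs"
  shows "P q xs \<longleftrightarrow> P q (map \<pi> xs)"
proof -
  let ?x = "\<lambda>a d (m :: nat). if m = 0 then a else d"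
  have "set xs \<subseteq> \<kappa> ` Cs \<union> ?x a d ` set [0, 1]" using xs(1) by auto
  then obtain p where p: "p \<in> patterns Cs (length [0, 1 :: nat]) (length xs)"
    and xs_eq: "xs = map (pattern_val (?x a d) \<kappa> [0, 1]) p"
    by (rule pattern_of_list)
  have "map \<pi> xs = map (pattern_val (?x a' d') \<kappa> [0, 1]) p"
    unfolding xs_eq by (rule map_pattern_val[OF p]) (auto simp: \<pi> less_Suc_eq)
  moreover have "p \<in> patterns Cs 2 2" using p xs(2) by (auto simp: patterns_def numeral_2_eq_2)
  ultimately have "P q xs \<longleftrightarrow> (q, p) \<in> pair_type Qs Cs P \<kappa> a d"
    "P q (map \<pi> xs) \<longleftrightarrow> (q, p) \<in> pair_type Qs Cs P \<kappa> a' d'"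
    using q xs_eq by (simp_all add: pair_type_def del: map_map map_eq_conv)
  with eq show ?thesis by simp
qed

text \<open>This is where arity 2 matters: a tuple of length at most 2 either consists of constants
  and elements of \<open>z\<close>, and homogeneity applies, or it contains \<open>a\<close> and at
  most one further element, and then a single pair type decides it.\<close>

lemma binary_type_invariant:
  assumes hom: "homogeneous Qs Cs 2 P \<kappa> z h" and "i < h"
    and g: "strict_mono_on {..i} g" "\<And>k. k \<le> i \<Longrightarrow> g k < h"
    and types: "\<And>k. k \<le> i \<Longrightarrow> pair_type Qs Cs P \<kappa> a (z k) = pair_type Qs Cs P \<kappa> a' (z (g k))"
    and \<pi>: "\<And>c. c \<in> Cs \<Longrightarrow> \<pi> (\<kappa> c) = \<kappa> c" "\<pi> a = a'" "\<And>k. k \<le> i \<Longrightarrow> \<pi> (z k) = z (g k)"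
    and xs: "set xs \<subseteq> \<kappa> ` Cs \<union> {a} \<union> z ` {..i}" "length xs \<le> 2" and q: "q \<in> Qs"
  shows "P q xs \<longleftrightarrow> P q (map \<pi> xs)"
proof (cases "set xs \<subseteq> \<kappa> ` Cs \<union> z ` {..i}")
  case True
  show ?thesis
    by (rule homogeneous_strict_mono_invariant[OF hom _ g(1) _ \<pi>(1) _ True xs(2) q])
      (use \<pi>(3) g(2) \<open>i < h\<close> in auto)
next
  case False
  then have "a \<in> set xs" using xs(1) by auto
  moreover have "xs = [] \<or> (\<exists>c. xs = [c]) \<or> (\<exists>c d. xs = [c, d])"
    using xs(2) by (cases xs; cases "tl xs") auto
  ultimately have "\<exists>c. set xs = {a, c}" by auto
  then obtain c where c: "set xs = {a, c}" by blast
  \<comment> \<open>If the other entry is a constant or \<open>a\<close> itself, any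
    \<open>k\<close> serves.\<close>
  have "\<exists>k\<le>i. set xs \<subseteq> \<kappa> ` Cs \<union> {a, z k}"
    using c xs(1) by auto
  then obtain k where k: "k \<le> i" "set xs \<subseteq> \<kappa> ` Cs \<union> {a, z k}" by blast
  show ?thesis
    by (rule pair_type_eq_invariant[OF types[OF k(1)] \<pi>(1) \<pi>(2) \<pi>(3)[OF k(1)] k(2) xs(2) q])
qed

section \<open>The substructure lemma\<close>

definition state_db ::
  "('ir, 'ic, 'ar, 'ac, 'br, 'bc, 'd) state \<Rightarrow>
   (('ir, 'ar, 'br) tagged, ('ic, 'ac, 'bc) tagged, 'd) database" where
  "state_db s = union_database (in_db s) (aux_db s) (bi_db s)"

lemma state_db_simps [simp]:
  "rel_val (state_db s) (In R) = rel_val (in_db s) R"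
  "rel_val (state_db s) (Aux R') = rel_val (aux_db s) R'"
  "rel_val (state_db s) (Bi R'') = rel_val (bi_db s) R''"
  "const_val (state_db s) (In c) = const_val (in_db s) c"
  "const_val (state_db s) (Aux c') = const_val (aux_db s) c'"
  "const_val (state_db s) (Bi c'') = const_val (bi_db s) c''"
  by (simp_all add: state_db_def union_database_def)

text \<open>All constants have to lie in \<open>C\<close>: then a term whose variables take values
  in \<open>C\<close> has its value in \<open>C\<close>, and atoms never look outside.\<close>

definition partial_iso ::
  "('r, 'c) schema \<Rightarrow> 'd set \<Rightarrow> ('d \<Rightarrow> 'd) \<Rightarrow> ('r, 'c, 'd) database \<Rightarrow> ('r, 'c, 'd) database \<Rightarrow> bool" where
  "partial_iso \<tau> C \<pi> U V \<longleftrightarrow> inj_on \<pi> C \<and>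
     (\<forall>c \<in> const_syms \<tau>. const_val U c \<in> C \<and> \<pi> (const_val U c) = const_val V c) \<and>
     (\<forall>R \<in> rel_syms \<tau>. \<forall>xs \<in> lists C. xs \<in> rel_val U R \<longleftrightarrow> map \<pi> xs \<in> rel_val V R)"

lemma partial_iso_sat:
  assumes iso: "partial_iso \<tau> C \<pi> U V"
    and "quantifier_free \<phi>" "formula_over \<tau> \<phi>"
    and "\<And>i. i \<in> free_vars \<phi> \<Longrightarrow> \<sigma> i \<in> C \<and> \<sigma>' i = \<pi> (\<sigma> i)"
  shows "sat D U \<sigma> \<phi> \<longleftrightarrow> sat D' V \<sigma>' \<phi>"
  using assms(2-)
proof (induction \<phi>)
  have trm: "term_val U \<sigma> u \<in> C \<and> term_val V \<sigma>' u = \<pi> (term_val U \<sigma> u)"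
    if "term_over \<tau> u" "\<And>i. i \<in> term_vars u \<Longrightarrow> \<sigma> i \<in> C \<and> \<sigma>' i = \<pi> (\<sigma> i)" for u
    using that iso by (cases u) (auto simp: partial_iso_def)
  case (Equal u v)
  then have "term_val U \<sigma> u \<in> C \<and> term_val V \<sigma>' u = \<pi> (term_val U \<sigma> u)"
    "term_val U \<sigma> v \<in> C \<and> term_val V \<sigma>' v = \<pi> (term_val U \<sigma> v)"
    using trm[of u] trm[of v] by auto
  then show ?case using iso by (auto simp: partial_iso_def inj_on_eq_iff)
next
  have trm: "term_val U \<sigma> u \<in> C \<and> term_val V \<sigma>' u = \<pi> (term_val U \<sigma> u)"
    if "term_over \<tau> u" "\<And>i. i \<in> term_vars u \<Longrightarrow> \<sigma> i \<in> C \<and> \<sigma>' i = \<pi> (\<sigma> i)" for u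
    using that iso by (cases u) (auto simp: partial_iso_def)
  case (Atom R us)
  have *: "term_val U \<sigma> u \<in> C \<and> term_val V \<sigma>' u = \<pi> (term_val U \<sigma> u)" if "u \<in> set us" for u
    using trm[of u] Atom that by auto
  then have "map (term_val V \<sigma>') us = map \<pi> (map (term_val U \<sigma>) us)"
    and "map (term_val U \<sigma>) us \<in> lists C" by auto
  then show ?case using iso Atom by (simp add: partial_iso_def del: map_map map_eq_conv)
qed auto

text \<open>Injectivity of \<open>\<pi>\<close> ensures that only the modified tuple is mapped to
  the modified tuple. For an auxiliary relation, \<open>partial_iso_sat\<close> transfers the update
  formula, evaluated at \<open>a @ xs\<close>; built-in relations do not change.\<close>

lemma partial_iso_apply_mod:
  assumes prog: "is_dynamic_program P" "is_quantifier_free_program P"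
    and iso: "partial_iso (full_schema P) C \<pi> (state_db s) (state_db s')"
    and dom: "C \<subseteq> dom_of s" "\<pi> ` C \<subseteq> dom_of s'"
    and S: "mod_sym \<delta> \<in> rel_syms (in_schema P)"
    and a: "a \<in> lists C" "length a = arity (in_schema P) (mod_sym \<delta>)"
  shows "partial_iso (full_schema P) C \<pi> (state_db (apply_mod P (\<delta>, a) s))
    (state_db (apply_mod P (\<delta>, map \<pi> a) s'))"
proof -
  let ?\<tau> = "full_schema P" and ?s = "apply_mod P (\<delta>, a) s" and ?s' = "apply_mod P (\<delta>, map \<pi> a) s'"
  have inj: "inj_on \<pi> C" using iso by (simp add: partial_iso_def)
  have old: "xs \<in> rel_val (state_db s) R \<longleftrightarrow> map \<pi> xs \<in> rel_val (state_db s') R"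
    if "R \<in> rel_syms ?\<tau>" "xs \<in> lists C" for R xs
    using iso that by (auto simp: partial_iso_def)
  have syms: "In R \<in> rel_syms ?\<tau> \<longleftrightarrow> R \<in> rel_syms (in_schema P)"
    "Aux R' \<in> rel_syms ?\<tau> \<longleftrightarrow> R' \<in> rel_syms (aux_schema P)" for R R'
    by (auto simp: full_schema_def union_schema_def)
  have const_eq: "const_val (state_db ?s) c = const_val (state_db s) c"
    "const_val (state_db ?s') c = const_val (state_db s') c" for c
    by (cases c; cases \<delta>; simp add: apply_mod_def updated_aux_def)+
  have "xs \<in> rel_val (state_db ?s) R \<longleftrightarrow> map \<pi> xs \<in> rel_val (state_db ?s') R"
    if R: "R \<in> rel_syms ?\<tau>" and xs: "xs \<in> lists C" for R xs
  proof (cases R)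
    case (In R')
    have "map \<pi> xs = map \<pi> a \<longleftrightarrow> xs = a"
      using inj_on_map_eq_map[of \<pi> xs a] inj a(1) xs
      by (metis Un_subset_iff in_lists_conv_set inj_on_subset le_sup_iff subsetI)
    then show ?thesis
      using old[OF R xs] In by (cases \<delta>) (auto simp: apply_mod_def)
  next
    case (Aux R')
    let ?\<phi> = "update_formula P R' \<delta>"
    have R': "R' \<in> rel_syms (aux_schema P)" using R Aux syms by simp
    have \<phi>: "quantifier_free ?\<phi>" "formula_over ?\<tau> ?\<phi>"
      "free_vars ?\<phi> \<subseteq> {..<length a + arity (aux_schema P) R'}"
      using prog R' S a(2) by (auto simp: is_dynamic_program_def is_quantifier_free_program_def)
    have tup: "xs \<in> tuples (dom_of s) n \<longleftrightarrow> map \<pi> xs \<in> tuples (dom_of s') n" for n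
      using xs dom by (auto simp: tuples_def)
    have "sat (dom_of s) (state_db s) (\<lambda>i. (a @ xs) ! i) ?\<phi>
        \<longleftrightarrow> sat (dom_of s') (state_db s') (\<lambda>i. (map \<pi> a @ map \<pi> xs) ! i) ?\<phi>"
      if "length xs = arity (aux_schema P) R'"
    proof (rule partial_iso_sat[OF iso \<phi>(1,2)])
      fix i assume "i \<in> free_vars ?\<phi>"
      then have i: "i < length (a @ xs)" using \<phi>(3) that by auto
      have "a @ xs \<in> lists C" using a xs by simp
      then have "(a @ xs) ! i \<in> C" using i nth_mem by (metis in_lists_conv_set)
      moreover have "(map \<pi> a @ map \<pi> xs) ! i = \<pi> ((a @ xs) ! i)"
        using i by (metis map_append nth_map)
      ultimately show "(a @ xs) ! i \<in> C \<and> (map \<pi> a @ map \<pi> xs) ! i = \<pi> ((a @ xs) ! i)" by simp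
    qed
    then show ?thesis
      using Aux R' tup by (auto simp: apply_mod_def updated_aux_def tuples_def state_db_def[symmetric])
  next
    case (Bi R')
    then show ?thesis using old[OF R xs] by (simp add: apply_mod_def)
  qed
  then show ?thesis using iso const_eq by (simp add: partial_iso_def)
qed

lemma dom_of_fold_apply_mod [simp]: "dom_of (fold (apply_mod P) ms s) = dom_of s"
  by (induction ms arbitrary: s) (auto simp: apply_mod_def)

lemma in_db_fold_apply_mod [simp]: "in_db (fold (apply_mod P) ms s) = fold modify ms (in_db s)"
  by (induction ms arbitrary: s) (auto simp: apply_mod_def)

lemma bi_db_fold_apply_mod [simp]: "bi_db (fold (apply_mod P) ms s) = bi_db s"
  by (induction ms arbitrary: s) (auto simp: apply_mod_def)

lemma const_val_fold_modify [simp]: "const_val (fold modify ms I) = const_val I"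
proof (induction ms arbitrary: I)
  case (Cons m ms)
  then show ?case by (cases m; cases "fst m") auto
qed simp

lemma const_val_aux_fold_apply_mod [simp]:
  "const_val (aux_db (fold (apply_mod P) ms s)) = const_val (aux_db s)"
  by (induction ms arbitrary: s) (auto simp: apply_mod_def updated_aux_def)

text \<open>Iterates the single step with the same \<open>C\<close> and \<open>\<pi>\<close>. As the
  empty tuple is mapped to itself, a Boolean query gets the same answer in both runs.\<close>

theorem substructure_lemma:
  assumes prog: "is_dynamic_program P" "is_quantifier_free_program P"
    and iso: "partial_iso (full_schema P) C \<pi> (state_db s) (state_db s')"
    and dom: "C \<subseteq> dom_of s" "\<pi> ` C \<subseteq> dom_of s'"
    and ms: "\<And>\<delta> a. (\<delta>, a) \<in> set ms \<Longrightarrow> is_modification (in_schema P) C (\<delta>, a)"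
  shows "partial_iso (full_schema P) C \<pi> (state_db (fold (apply_mod P) ms s))
    (state_db (fold (apply_mod P) (map (\<lambda>(\<delta>, a). (\<delta>, map \<pi> a)) ms) s'))"
  using ms
proof (induction ms rule: rev_induct)
  case Nil
  then show ?case using iso by simp
next
  case (snoc m ms)
  obtain \<delta> a where m: "m = (\<delta>, a)" by (cases m)
  have "is_modification (in_schema P) C (\<delta>, a)" using snoc.prems[of \<delta> a] m by simp
  then have *: "mod_sym \<delta> \<in> rel_syms (in_schema P)" "a \<in> lists C"
    "length a = arity (in_schema P) (mod_sym \<delta>)"
    by (auto simp: is_modification_def tuples_def)
  have "partial_iso (full_schema P) C \<pi> (state_db (fold (apply_mod P) ms s))
    (state_db (fold (apply_mod P) (map (\<lambda>(\<delta>, a). (\<delta>, map \<pi> a)) ms) s'))"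
    using snoc by simp
  from partial_iso_apply_mod[OF prog this _ _ *] dom show ?case by (simp add: m)
qed

section \<open>Well-formedness of databases along runs\<close>

lemma is_database_rel_val_subset:
  "is_database \<tau> D I \<Longrightarrow> rel_val I R \<subseteq> tuples D (arity \<tau> R)"
  by (cases "R \<in> rel_syms \<tau>") (auto simp: is_database_def dest!: spec[of _ R])

lemma is_database_fold_modify:
  assumes "is_database \<tau> D I" "\<forall>m \<in> set ms. is_modification \<tau> D m"
  shows "is_database \<tau> D (fold modify ms I)"
  using assms
proof (induction ms arbitrary: I)
  case (Cons m ms)
  have "is_database \<tau> D (modify m I)"
    using Cons.prems
    by (cases "(m, I)" rule: modify.cases)
      (fastforce simp: is_database_def is_modification_def split: if_splits)+
  then show ?case using Cons by simp
qed simp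

lemma is_database_aux_apply_mod:
  assumes "is_database (aux_schema P) (dom_of s) (aux_db s)"
  shows "is_database (aux_schema P) (dom_of s) (aux_db (apply_mod P m s))"
  using assms by (auto simp: is_database_def apply_mod_def updated_aux_def)

lemma is_database_aux_fold_apply_mod:
  assumes "is_database (aux_schema P) (dom_of s) (aux_db s)"
  shows "is_database (aux_schema P) (dom_of s) (aux_db (fold (apply_mod P) ms s))"
  using assms
proof (induction ms rule: rev_induct)
  case (snoc m ms)
  from is_database_aux_apply_mod[of P "fold (apply_mod P) ms s" m] snoc show ?case by simp
qed simp

section \<open>Fan graphs\<close>

text \<open>Three layers: a node \<open>a Y\<close> for every subset \<open>Y\<close>, then the
  nodes \<open>y k\<close>, then \<open>t\<close>. The source is left out; a later edge from it to
  \<open>a Y\<close> selects \<open>Y\<close>.\<close>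

definition fan_edges :: "nat \<Rightarrow> 'd \<Rightarrow> (nat set \<Rightarrow> 'd) \<Rightarrow> (nat \<Rightarrow> 'd) \<Rightarrow> 'd list set" where
  "fan_edges b t a y = (\<lambda>k. [y k, t]) ` {..<b} \<union>
     (\<lambda>(Y, k). [a Y, y k]) ` (Pow {..<b} \<times> {..<b} \<inter> {(Y, k). k \<in> Y})"

lemma finite_fan_edges: "finite (fan_edges b t a y)"
  by (simp add: fan_edges_def)

lemma fan_edges_tuples:
  assumes "t \<in> D" "\<And>Y. Y \<subseteq> {..<b} \<Longrightarrow> a Y \<in> D" "\<And>k. k < b \<Longrightarrow> y k \<in> D"
  shows "fan_edges b t a y \<subseteq> tuples D 2"
  using assms by (auto simp: fan_edges_def tuples_def)

text \<open>Every path from \<open>s\<close> to \<open>t\<close> passes through \<open>a Y\<close>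
  and some \<open>y k\<close> with \<open>k \<in> Y\<close>, and its last edge survives only if
  \<open>k \<notin> X\<close>.\<close>

lemma fan_reachable_iff:
  assumes inj: "inj_on y {..<b}" "inj_on a (Pow {..<b})"
    and disj: "\<And>Y k. Y \<subseteq> {..<b} \<Longrightarrow> k < b \<Longrightarrow> a Y \<noteq> y k"
      "\<And>Y. Y \<subseteq> {..<b} \<Longrightarrow> a Y \<notin> {s, t}" "\<And>k. k < b \<Longrightarrow> y k \<notin> {s, t}" "s \<noteq> t"
    and Y: "Y \<subseteq> {..<b}" and X: "X \<subseteq> {..<b}"
  shows "(s, t) \<in> {(u, v). [u, v] \<in> insert [s, a Y] (fan_edges b t a y) - (\<lambda>k. [y k, t]) ` X}\<^sup>*
    \<longleftrightarrow> \<not> Y \<subseteq> X" (is "_ \<in> ?E\<^sup>* \<longleftrightarrow> _")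
proof
  assume "\<not> Y \<subseteq> X"
  then obtain k where k: "k \<in> Y" "k \<notin> X" by blast
  with Y have kb: "k < b" by blast
  have "(s, a Y) \<in> ?E" using disj Y X by auto
  moreover have "(a Y, y k) \<in> ?E" using k kb Y X disj by (auto simp: fan_edges_def)
  moreover have "(y k, t) \<in> ?E"
    using k kb X inj(1) by (auto simp: fan_edges_def inj_on_def subset_iff)
  ultimately show "(s, t) \<in> ?E\<^sup>*" by (meson converse_rtrancl_into_rtrancl rtrancl.rtrancl_refl)
next
  assume reach: "(s, t) \<in> ?E\<^sup>*"
  show "\<not> Y \<subseteq> X"
  proof
    assume "Y \<subseteq> X"
    \<comment> \<open>If \<open>Y \<subseteq> X\<close>, this set is closed under the edges and
      misses \<open>t\<close>.\<close>
    let ?R = "insert s (insert (a Y) (y ` Y))"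
    have closed: "v \<in> ?R" if uv: "(u, v) \<in> ?E" "u \<in> ?R" for u v
    proof -
      consider "u = s" "v = a Y" | k where "k < b" "u = y k" "v = t" "k \<notin> X"
        | Z k where "Z \<subseteq> {..<b}" "k \<in> Z" "u = a Z" "v = y k"
        using uv(1) by (auto simp: fan_edges_def)
      then show ?thesis
      proof cases
        case 2
        then have "y k \<in> y ` Y" using uv(2) disj(1)[OF Y \<open>k < b\<close>] disj(3)[OF \<open>k < b\<close>] by auto
        then have "k \<in> Y" using inj_on_image_mem_iff[OF inj(1)] 2(1) Y by blast
        then show ?thesis using 2 \<open>Y \<subseteq> X\<close> by blast
      next
        case 3
        then have "a Z = a Y" using uv(2) disj(1,2)[OF 3(1)] Y by auto
        then have "Z = Y" using inj_onD[OF inj(2)] 3(1) Y by simp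
        then show ?thesis using 3 by blast
      qed auto
    qed
    have "v \<in> ?R" if "(s, v) \<in> ?E\<^sup>*" for v
      using that by (induction rule: rtrancl_induct) (use closed in blast)+
    then have "t \<in> ?R" using reach by blast
    then show False using disj(2)[OF Y] disj(3,4) subsetD[OF Y] by auto
  qed
qed

lemma rel_val_fold_insert:
  "rel_val (fold modify (map (\<lambda>x. (Ins S, x)) L) I) S = rel_val I S \<union> set L"
  by (induction L arbitrary: I) auto

lemma rel_val_fold_delete:
  "rel_val (fold modify (map (\<lambda>x. (Del S, x)) L) I) S = rel_val I S - set L"
  by (induction L arbitrary: I) auto

section \<open>The lower bound\<close>

lemma finite_full_schema:
  assumes "is_dynamic_program P"
  shows "finite (rel_syms (full_schema P))" "finite (const_syms (full_schema P))"
  using assms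
  by (simp_all add: is_dynamic_program_def finite_schema_def full_schema_def union_schema_def)

theorem theorem4p7:
  assumes "infinite (UNIV :: 'd set)"
  shows "\<not> (\<exists>P :: (st_rel, st_const, 'ar, 'ac, 'br, 'bc, 'd) dynamic_program.
           is_dynamic_program P \<and> in_schema P = st_schema \<and>
           is_quantifier_free_program P \<and> is_binary_program P \<and>
           maintains P st_reachability)"
proof
  assume "\<exists>P :: (st_rel, st_const, 'ar, 'ac, 'br, 'bc, 'd) dynamic_program.
           is_dynamic_program P \<and> in_schema P = st_schema \<and>
           is_quantifier_free_program P \<and> is_binary_program P \<and>
           maintains P st_reachability"
  then obtain P :: "(st_rel, st_const, 'ar, 'ac, 'br, 'bc, 'd) dynamic_program"
    where prog: "is_dynamic_program P" "is_quantifier_free_program P"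
      and st: "in_schema P = st_schema" and binary: "is_binary_program P"
      and maint: "maintains P st_reachability"
    by blast

  \<comment> \<open>Symbols and bounds of the program\<close>
  define Cs where "Cs = const_syms (full_schema P)"
  \<comment> \<open>Input and auxiliary symbols have arity at most 2 but change during a run; the
    built-in symbols in \<open>Qb\<close> have arbitrary arity but never change. Hence the two
    separate uses of Ramsey's theorem.\<close>
  define Qa :: "(st_rel, 'ar, 'br) tagged set"
    where "Qa = In ` rel_syms (in_schema P) \<union> Aux ` rel_syms (aux_schema P)"
  define Qb :: "(st_rel, 'ar, 'br) tagged set"
    where "Qb = Bi ` rel_syms (bi_schema P)"
  have syms: "rel_syms (full_schema P) = Qa \<union> Qb"
    by (simp add: full_schema_def union_schema_def Qa_def Qb_def)
  have fin: "finite Cs" "finite Qa" "finite Qb"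
    using finite_full_schema[OF prog(1)] by (auto simp: Cs_def syms)
  have "finite (arity (full_schema P) ` Qb)" using fin by simp
  then obtain r where r: "\<And>q. q \<in> Qb \<Longrightarrow> arity (full_schema P) q \<le> r"
    by (auto simp: finite_nat_set_iff_bounded_le)
  have arity_Qa: "arity (full_schema P) q \<le> 2" if "q \<in> Qa" for q
    using that binary st
    by (auto simp: Qa_def full_schema_def union_schema_def is_binary_program_def st_schema_def)

  \<comment> \<open>The bounds are chosen backwards and depend on the program alone:
    \<open>n\<close> suits Higman's lemma over the alphabet of pair types, \<open>b\<close> yields
    \<open>Suc n\<close> elements homogeneous for \<open>Qa\<close>, and \<open>N\<close> yields
    \<open>2 ^ b + b\<close> elements homogeneous for \<open>Qb\<close>, one for each subset of
    \<open>{..<b}\<close> and \<open>b\<close> more.\<close>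
  have "finite (Pow (Qa \<times> patterns Cs 2 2))" using fin by (simp add: finite_patterns)
  from finite_higman[OF this] obtain n where higman_n: "\<forall>w. (\<forall>i\<le>n. length (w i) = Suc i \<and>
        set (w i) \<subseteq> Pow (Qa \<times> patterns Cs 2 2))
      \<longrightarrow> (\<exists>i j. i < j \<and> j \<le> n \<and> subseq (w i) (w j))"
    by (rule exE)
  from ramsey_homogeneous[OF fin(2,1), where h = "Suc n" and r = 2]
  obtain b :: nat where ramsey_b: "\<forall>(P :: (st_rel, 'ar, 'br) tagged \<Rightarrow> 'd list \<Rightarrow> bool) \<kappa> x.
      \<exists>\<iota>. strict_mono_on {..<Suc n} \<iota> \<and> \<iota> ` {..<Suc n} \<subseteq> {..<b} \<and>
        homogeneous Qa Cs 2 P \<kappa> (x \<circ> \<iota>) (Suc n)"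
    by (rule exE)
  from ramsey_homogeneous[OF fin(3,1), where h = "2 ^ b + b" and r = r]
  obtain N :: nat where ramsey_N: "\<forall>(P :: (st_rel, 'ar, 'br) tagged \<Rightarrow> 'd list \<Rightarrow> bool) \<kappa> x.
      \<exists>\<iota>. strict_mono_on {..<2 ^ b + b} \<iota> \<and> \<iota> ` {..<2 ^ b + b} \<subseteq> {..<N} \<and>
        homogeneous Qb Cs r P \<kappa> (x \<circ> \<iota>) (2 ^ b + b)"
    by (rule exE)

  \<comment> \<open>The summand \<open>card Cs\<close> leaves room to avoid all constants; the
    summand 2 provides distinct \<open>s\<close> and \<open>t\<close>.\<close>
  obtain D :: "'d set" where D: "finite D" "card D = N + card Cs + 2"
    using infinite_arbitrarily_large[OF assms] by blast
  then obtain s where s: "s \<in> D" by fastforce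
  have "card (D - {s}) \<noteq> 0" using D s by simp
  then obtain t where t: "t \<in> D" "s \<noteq> t" by (metis DiffE card.empty equals0I singletonI)
  define I\<^sub>0 :: "(st_rel, st_const, 'd) database"
    where "I\<^sub>0 = \<lparr>rel_val = (\<lambda>_. {}), const_val = (\<lambda>c. case c of Source \<Rightarrow> s | Target \<Rightarrow> t)\<rparr>"
  have I\<^sub>0: "is_database st_schema D I\<^sub>0"
    using D s t by (auto simp: is_database_def I\<^sub>0_def st_schema_def split: st_const.splits)
  define s\<^sub>0 where "s\<^sub>0 = initial_state P D I\<^sub>0"
  \<comment> \<open>Auxiliary and built-in constants get their values from the initialization and
    keep them in all later states.\<close>
  define \<kappa> where "\<kappa> = const_val (state_db s\<^sub>0)"
  have dom: "dom_of s\<^sub>0 = D" by (simp add: s\<^sub>0_def initial_state_def)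
  have in_db: "in_db s\<^sub>0 = I\<^sub>0" by (simp add: s\<^sub>0_def initial_state_def)
  have aux_db: "is_database (aux_schema P) D (aux_db s\<^sub>0)"
    and bi_db: "is_database (bi_schema P) D (bi_db s\<^sub>0)"
    using prog(1) I\<^sub>0 st D by (auto simp: is_dynamic_program_def s\<^sub>0_def initial_state_def)
  have \<kappa>_D: "\<kappa> ` Cs \<subseteq> D"
    using I\<^sub>0 aux_db bi_db st in_db
    by (auto simp: \<kappa>_def Cs_def full_schema_def union_schema_def is_database_def)
  have \<kappa>_st: "s \<in> \<kappa> ` Cs" "t \<in> \<kappa> ` Cs"
  proof -
    have "In Source \<in> Cs" "In Target \<in> Cs" "\<kappa> (In Source) = s" "\<kappa> (In Target) = t"
      using st in_db
      by (auto simp: \<kappa>_def Cs_def full_schema_def union_schema_def st_schema_def I\<^sub>0_def)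
    then show "s \<in> \<kappa> ` Cs" "t \<in> \<kappa> ` Cs" by (metis imageI)+
  qed

  \<comment> \<open>Homogeneity for the built-in relations\<close>
  have "N \<le> card (D - \<kappa> ` Cs)"
    using D(2) diff_card_le_card_Diff[of "\<kappa> ` Cs" D] card_image_le[OF fin(1), of \<kappa>] fin(1)
    by fastforce
  then obtain x\<^sub>0 where x\<^sub>0: "inj_on x\<^sub>0 {..<N}" "x\<^sub>0 ` {..<N} \<subseteq> D - \<kappa> ` Cs"
    using D(1) card_le_inj[of "{..<N}" "D - \<kappa> ` Cs"] by auto
  obtain \<iota>\<^sub>1 where \<iota>\<^sub>1: "strict_mono_on {..<2 ^ b + b} \<iota>\<^sub>1" "\<iota>\<^sub>1 ` {..<2 ^ b + b} \<subseteq> {..<N}"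
    and hom_x: "homogeneous Qb Cs r (\<lambda>q xs. xs \<in> rel_val (state_db s\<^sub>0) q) \<kappa> (x\<^sub>0 \<circ> \<iota>\<^sub>1) (2 ^ b + b)"
    using ramsey_N by blast
  define x where "x = x\<^sub>0 \<circ> \<iota>\<^sub>1"
  have x_inj: "inj_on x {..<2 ^ b + b}"
    unfolding x_def using \<iota>\<^sub>1 x\<^sub>0(1)
    by (meson comp_inj_on inj_on_subset strict_mono_on_imp_inj_on)
  have x_D: "x m \<in> D" and x_\<kappa>: "x m \<notin> \<kappa> ` Cs" if "m < 2 ^ b + b" for m
    using that \<iota>\<^sub>1(2) x\<^sub>0(2) by (auto simp: x_def)
  have x_eq: "x m = x m' \<longleftrightarrow> m = m'" if "m < 2 ^ b + b" "m' < 2 ^ b + b" for m m'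
    using x_inj that by (auto simp: inj_on_def)

  \<comment> \<open>Numbering the subsets below \<open>2 ^ b\<close> puts every \<open>a Y\<close>
    before every \<open>y k\<close> in the sequence \<open>x\<close>, so replacing one
    \<open>a Y\<close> by another keeps its order relative to the \<open>y k\<close>.\<close>
  have "card (Pow {..<b}) = card {..<(2::nat) ^ b}" by (simp add: card_Pow)
  then obtain \<alpha> where "bij_betw \<alpha> (Pow {..<b}) {..<(2::nat) ^ b}"
    using finite_same_card_bij by (metis finite_Pow_iff finite_lessThan)
  then have \<alpha>_inj: "inj_on \<alpha> (Pow {..<b})" and \<alpha>: "\<And>Y. Y \<subseteq> {..<b} \<Longrightarrow> \<alpha> Y < 2 ^ b"
    by (auto simp: bij_betw_def)
  define y where "y k = x (2 ^ b + k)" for k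
  define a where "a Y = x (\<alpha> Y)" for Y
  have a_less: "\<alpha> Y < 2 ^ b + b" if "Y \<subseteq> {..<b}" for Y using \<alpha>[OF that] by simp
  have a_D: "a Y \<in> D" "a Y \<notin> \<kappa> ` Cs" if "Y \<subseteq> {..<b}" for Y
    using x_D x_\<kappa> a_less[OF that] by (auto simp: a_def)
  have y_D: "y k \<in> D" "y k \<notin> \<kappa> ` Cs" if "k < b" for k
    using x_D x_\<kappa> that by (auto simp: y_def)
  have a_y: "a Y \<noteq> y k" if "Y \<subseteq> {..<b}" "k < b" for Y k
    using \<alpha>[OF that(1)] that(2) by (auto simp: a_def y_def x_eq)
  have y_inj: "inj_on y {..<b}" by (auto simp: inj_on_def y_def x_eq)
  have a_inj: "inj_on a (Pow {..<b})"
    using \<alpha>_inj a_less by (auto simp: inj_on_def a_def x_eq)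

  \<comment> \<open>The state after inserting the fan\<close>
  obtain L where L: "set L = fan_edges b t a y"
    using finite_list[OF finite_fan_edges, of b t a y] by (rule exE)
  define ms\<^sub>0 where "ms\<^sub>0 = map (\<lambda>e. (Ins Edge, e)) L"
  define s\<^sub>1 where "s\<^sub>1 = fold (apply_mod P) ms\<^sub>0 s\<^sub>0"
  have ms\<^sub>0: "\<forall>m \<in> set ms\<^sub>0. is_modification st_schema D m"
    using fan_edges_tuples[of t D b a y] t a_D y_D L
    by (auto simp: ms\<^sub>0_def is_modification_def st_schema_def)
  have const_s\<^sub>1: "const_val (state_db s\<^sub>1) = \<kappa>"
  proof
    show "const_val (state_db s\<^sub>1) c = \<kappa> c" for c
      by (cases c) (simp_all add: s\<^sub>1_def \<kappa>_def)
  qed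
  have tuples_s\<^sub>1: "rel_val (state_db s\<^sub>1) q \<subseteq> tuples D (arity (full_schema P) q)" for q
  proof -
    have "is_database st_schema D (in_db s\<^sub>1)"
      using is_database_fold_modify[OF I\<^sub>0 ms\<^sub>0] by (simp add: s\<^sub>1_def in_db)
    moreover have "is_database (aux_schema P) D (aux_db s\<^sub>1)"
      using is_database_aux_fold_apply_mod[of P s\<^sub>0] aux_db dom by (simp add: s\<^sub>1_def)
    moreover have "is_database (bi_schema P) D (bi_db s\<^sub>1)"
      using bi_db by (simp add: s\<^sub>1_def)
    ultimately show ?thesis
      using st by (cases q) (simp_all add: is_database_rel_val_subset full_schema_def union_schema_def)
  qed
  \<comment> \<open>\<open>partial_iso\<close> speaks about tuples of every length; those longer
    than the arity belong to no relation, and \<open>map \<pi>\<close> keeps the length.\<close>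
  have long: "xs \<in> rel_val (state_db s\<^sub>1) q \<longleftrightarrow> map \<pi> xs \<in> rel_val (state_db s\<^sub>1) q"
    if "arity (full_schema P) q < length xs" for q xs and \<pi> :: "'d \<Rightarrow> 'd"
  proof -
    have "length zs = arity (full_schema P) q" if "zs \<in> rel_val (state_db s\<^sub>1) q" for zs
      using tuples_s\<^sub>1 that by (fastforce simp: tuples_def)
    from this[of xs] this[of "map \<pi> xs"] that show ?thesis by auto
  qed

  \<comment> \<open>The auxiliary relations depend on the inserted edges, so a part homogeneous for
    them is found only now. Since it is unknown beforehand, the fan has a node for every subset of
    \<open>{..<b}\<close>.\<close>
  obtain \<iota>\<^sub>2 where \<iota>\<^sub>2: "strict_mono_on {..<Suc n} \<iota>\<^sub>2" "\<iota>\<^sub>2 ` {..<Suc n} \<subseteq> {..<b}"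
    and hom_z: "homogeneous Qa Cs 2 (\<lambda>q xs. xs \<in> rel_val (state_db s\<^sub>1) q) \<kappa> (y \<circ> \<iota>\<^sub>2) (Suc n)"
    using ramsey_b[rule_format, of "\<lambda>q xs. xs \<in> rel_val (state_db s\<^sub>1) q" \<kappa> y] by auto
  define z where "z = y \<circ> \<iota>\<^sub>2"
  have \<iota>\<^sub>2_less: "\<iota>\<^sub>2 k < b" if "k \<le> n" for k
    using subsetD[OF \<iota>\<^sub>2(2), of "\<iota>\<^sub>2 k"] that by simp
  have \<iota>\<^sub>2_inj: "inj_on \<iota>\<^sub>2 {..<Suc n}" by (rule strict_mono_on_imp_inj_on[OF \<iota>\<^sub>2(1)])
  have z_eq: "z k = z k' \<longleftrightarrow> k = k'" if "k \<le> n" "k' \<le> n" for k k'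
    using that \<iota>\<^sub>2_less \<iota>\<^sub>2_inj y_inj by (auto simp: z_def inj_on_def)
  define Y where "Y i = \<iota>\<^sub>2 ` {..i}" for i
  have Y_sub: "Y i \<subseteq> {..<b}" if "i \<le> n" for i using that \<iota>\<^sub>2_less by (auto simp: Y_def)
  define letter where
    "letter i k = pair_type Qa Cs (\<lambda>q xs. xs \<in> rel_val (state_db s\<^sub>1) q) \<kappa> (a (Y i)) (z k)" for i k
  \<comment> \<open>Word \<open>i\<close> records how \<open>a (Y i)\<close> relates to
    \<open>z 0\<close>, ..., \<open>z i\<close>; it has length \<open>Suc i\<close>, as the finite
    form of Higman's lemma requires.\<close>
  define w where "w i = map (letter i) [0..<Suc i]" for i
  have "\<exists>i j. i < j \<and> j \<le> n \<and> subseq (w i) (w j)"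
  proof (rule higman_n[rule_format])
    show "length (w i) = Suc i \<and> set (w i) \<subseteq> Pow (Qa \<times> patterns Cs 2 2)" if "i \<le> n" for i
      using pair_type_in_Pow by (fastforce simp: w_def letter_def simp del: upt_Suc)
  qed
  then obtain i j where ij: "i < j" "j \<le> n" and sub: "subseq (w i) (w j)" by blast
  have i_n: "i \<le> n" using ij by simp
  have w_len: "length (w i) = Suc i" for i by (simp add: w_def)
  have w_nth: "w i ! k = letter i k" if "k < Suc i" for i k
    using that by (simp add: w_def del: upt_Suc)
  from subseq_index_map[OF sub] obtain g where "strict_mono_on {..<length (w i)} g"
    and g_w: "\<forall>k<length (w i). g k < length (w j) \<and> w j ! g k = w i ! k"
    by blast
  then have g: "strict_mono_on {..i} g" by (simp add: w_len lessThan_Suc_atMost)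
  have g_le: "g k \<le> j" and letters: "letter i k = letter j (g k)" if "k \<le> i" for k
    using g_w that w_nth by (auto simp: w_len less_Suc_eq_le)

  \<comment> \<open>The partial isomorphism\<close>
  define C where "C = \<kappa> ` Cs \<union> {a (Y i)} \<union> z ` {..i}"
  \<comment> \<open>\<open>\<pi>\<close> carries the position map \<open>g\<close> over to elements;
    \<open>inv_into\<close> recovers the position of an element of \<open>z\<close>.\<close>
  define \<pi> where "\<pi> d = (if d = a (Y i) then a (Y j)
    else if d \<in> z ` {..i} then z (g (inv_into {..i} z d)) else d)" for d
  have a_z: "a (Y i') \<noteq> z k" if "i' \<le> n" "k \<le> n" for i' k
    using a_y Y_sub \<iota>\<^sub>2_less that by (auto simp: z_def)
  have a_\<kappa>: "a (Y i') \<notin> \<kappa> ` Cs" if "i' \<le> n" for i'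
    using a_D(2)[OF Y_sub[OF that]] .
  have z_\<kappa>: "z k \<notin> \<kappa> ` Cs" if "k \<le> n" for k using y_D \<iota>\<^sub>2_less that by (auto simp: z_def)
  have g_n: "g k \<le> n" if "k \<le> i" for k using g_le[OF that] ij by simp
  have \<pi>_a: "\<pi> (a (Y i)) = a (Y j)" by (simp add: \<pi>_def)
  have \<pi>_z: "\<pi> (z k) = z (g k)" if "k \<le> i" for k
  proof -
    have "inj_on z {..i}" using z_eq ij by (auto simp: inj_on_def)
    then show ?thesis using that ij a_z[of i k] by (auto simp: \<pi>_def)
  qed
  have \<pi>_\<kappa>: "\<pi> d = d" if "d \<in> \<kappa> ` Cs" for d
  proof -
    have "z k \<noteq> d" if "k \<le> i" for k using z_\<kappa>[of k] that ij \<open>d \<in> \<kappa> ` Cs\<close> by auto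
    then have "d \<notin> z ` {..i}" by auto
    moreover have "d \<noteq> a (Y i)" using a_\<kappa>[OF i_n] that by blast
    ultimately show ?thesis by (simp add: \<pi>_def)
  qed
  have g_inj: "g k = g k' \<longleftrightarrow> k = k'" if "k \<le> i" "k' \<le> i" for k k'
    using inj_on_eq_iff[OF strict_mono_on_imp_inj_on[OF g]] that by simp
  \<comment> \<open>\<open>C\<close> splits into the constants, the elements of \<open>z\<close> and
    \<open>a (Y i)\<close>; \<open>\<pi>\<close> is injective on each part, and the images are
    disjoint.\<close>
  have \<pi>_inj: "inj_on \<pi> C"
  proof -
    have \<pi>_K: "\<pi> ` A \<subseteq> \<kappa> ` Cs" if "A \<subseteq> \<kappa> ` Cs" for A
      using \<pi>_\<kappa> that by (simp add: image_subset_iff subset_iff)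
    have \<pi>_Z: "\<pi> ` A \<subseteq> z ` g ` {..i}" if "A \<subseteq> z ` {..i}" for A
    proof
      fix d assume "d \<in> \<pi> ` A"
      then obtain k where "k \<le> i" "d = \<pi> (z k)" using \<open>A \<subseteq> z ` {..i}\<close> by auto
      then show "d \<in> z ` g ` {..i}" by (simp add: \<pi>_z)
    qed
    have disj_Z: "z ` g ` {..i} \<inter> \<kappa> ` Cs = {}" using z_\<kappa>[OF g_n] by auto
    have disj_a: "a (Y j) \<notin> \<kappa> ` Cs \<union> z ` g ` {..i}"
      using a_\<kappa>[OF ij(2)] a_z[OF ij(2) g_n] by auto
    have "inj_on \<pi> (\<kappa> ` Cs)" using \<pi>_\<kappa> by (simp add: inj_on_def)
    moreover have "inj_on \<pi> (z ` {..i})"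
      by (auto simp: inj_on_def \<pi>_z z_eq g_n g_inj)
    ultimately have "inj_on \<pi> (\<kappa> ` Cs \<union> z ` {..i})"
      using \<pi>_K[OF Diff_subset] \<pi>_Z[OF Diff_subset] disj_Z unfolding inj_on_Un by blast
    moreover have "\<pi> ` (\<kappa> ` Cs \<union> z ` {..i}) \<subseteq> \<kappa> ` Cs \<union> z ` g ` {..i}"
      unfolding image_Un using \<pi>_K[OF subset_refl] \<pi>_Z[OF subset_refl] by (rule Un_mono)
    ultimately have "inj_on \<pi> (insert (a (Y i)) (\<kappa> ` Cs \<union> z ` {..i}))"
      unfolding inj_on_insert \<pi>_a using disj_a by blast
    then show ?thesis by (simp add: C_def)
  qed
  have C_D: "C \<subseteq> D" "\<pi> ` C \<subseteq> D"
  proof -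
    have z_D: "z k \<in> D" if "k \<le> n" for k using y_D(1)[OF \<iota>\<^sub>2_less[OF that]] by (simp add: z_def)
    show "C \<subseteq> D"
      using \<kappa>_D a_D(1)[OF Y_sub[OF i_n]] z_D i_n by (auto simp: C_def)
    have "\<pi> d \<in> D" if "d \<in> C" for d
    proof -
      consider "d \<in> \<kappa> ` Cs" | "d = a (Y i)" | k where "k \<le> i" "d = z k"
        using \<open>d \<in> C\<close> by (auto simp: C_def)
      then show ?thesis
        by cases (use \<kappa>_D \<pi>_\<kappa> \<pi>_a \<pi>_z a_D(1)[OF Y_sub[OF ij(2)]] z_D g_n in auto)
    qed
    then show "\<pi> ` C \<subseteq> D" by auto
  qed

  have rel_bi: "xs \<in> rel_val (state_db s\<^sub>1) q \<longleftrightarrow> map \<pi> xs \<in> rel_val (state_db s\<^sub>1) q"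
    if q: "q \<in> Qb" and xs: "xs \<in> lists C" for q xs
  proof (cases "length xs \<le> r")
    case False
    then show ?thesis using long[of q xs \<pi>] r[OF q] by linarith
  next
    case True
    \<comment> \<open>\<open>J\<close> holds the positions in \<open>x\<close> of the elements of
      \<open>C\<close> outside the constants, and \<open>\<gamma>\<close> is \<open>\<pi>\<close>
      read on positions. Only \<open>\<alpha> (Y i)\<close> lies below \<open>2 ^ b\<close> in
      \<open>J\<close>, so the test \<open>m < 2 ^ b\<close> recognises it.\<close>
    define J where "J = insert (\<alpha> (Y i)) ((\<lambda>k. 2 ^ b + \<iota>\<^sub>2 k) ` {..i})"
    define \<gamma> where "\<gamma> m = (if m < 2 ^ b then \<alpha> (Y j)
      else 2 ^ b + \<iota>\<^sub>2 (g (inv_into {..i} \<iota>\<^sub>2 (m - 2 ^ b))))" for m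
    have "inj_on \<iota>\<^sub>2 {..i}" using \<iota>\<^sub>2_inj ij by (auto simp: inj_on_def)
    then have \<gamma>_z: "\<gamma> (2 ^ b + \<iota>\<^sub>2 k) = 2 ^ b + \<iota>\<^sub>2 (g k)" if "k \<le> i" for k
      using that by (simp add: \<gamma>_def)
    have \<gamma>_a: "\<gamma> (\<alpha> (Y i)) = \<alpha> (Y j)" using \<alpha> Y_sub ij by (simp add: \<gamma>_def)
    have \<alpha>_ij: "\<alpha> (Y i) < 2 ^ b" "\<alpha> (Y j) < 2 ^ b" using \<alpha> Y_sub ij by auto
    have \<iota>\<^sub>2_mono: "\<iota>\<^sub>2 k < \<iota>\<^sub>2 k' \<longleftrightarrow> k < k'" if "k \<le> n" "k' \<le> n" for k k'
      using strict_mono_on_less[OF \<iota>\<^sub>2(1)] that by simp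
    have J: "J \<subseteq> {..<2 ^ b + b}" "\<gamma> ` J \<subseteq> {..<2 ^ b + b}"
      using \<alpha>_ij \<iota>\<^sub>2_less ij g_n by (auto simp: J_def \<gamma>_a \<gamma>_z)
    \<comment> \<open>The one position below \<open>2 ^ b\<close> stays below it, and on the others
      both \<open>g\<close> and \<open>\<iota>\<^sub>2\<close> are increasing.\<close>
    have J_mono: "strict_mono_on J \<gamma>"
    proof (rule strict_mono_onI)
      fix m m' assume m: "m \<in> J" "m' \<in> J" "m < m'"
      from m(2) consider "m' = \<alpha> (Y i)" | k' where "k' \<le> i" "m' = 2 ^ b + \<iota>\<^sub>2 k'"
        by (auto simp: J_def)
      then show "\<gamma> m < \<gamma> m'"
      proof cases
        case 1
        then show ?thesis using m \<alpha>_ij by (auto simp: J_def)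
      next
        case 2
        from m(1) consider "m = \<alpha> (Y i)" | k where "k \<le> i" "m = 2 ^ b + \<iota>\<^sub>2 k"
          by (auto simp: J_def)
        then show ?thesis
        proof cases
          case 1
          then show ?thesis using 2 \<gamma>_a \<gamma>_z \<alpha>_ij by simp
        next
          case k: 2
          then have "k < k'" using 2 m(3) \<iota>\<^sub>2_mono ij by simp
          then have "g k < g k'" using g k 2 by (auto simp: strict_mono_on_def)
          then show ?thesis using k 2 \<gamma>_z \<iota>\<^sub>2_mono g_n by simp
        qed
      qed
    qed
    have C_J: "set xs \<subseteq> \<kappa> ` Cs \<union> x ` J"
    proof -
      have "C = \<kappa> ` Cs \<union> x ` J" by (auto simp: C_def J_def a_def z_def y_def)
      then show ?thesis using xs by auto
    qed
    have "xs \<in> rel_val (state_db s\<^sub>0) q \<longleftrightarrow> map \<pi> xs \<in> rel_val (state_db s\<^sub>0) q"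
    proof (rule homogeneous_strict_mono_invariant[OF hom_x[folded x_def] J(1) J_mono J(2) _ _ C_J True q])
      show "\<pi> (\<kappa> c) = \<kappa> c" if "c \<in> Cs" for c using \<pi>_\<kappa> that by blast
      show "\<pi> (x m) = x (\<gamma> m)" if "m \<in> J" for m
        using that \<pi>_a \<pi>_z \<gamma>_a \<gamma>_z by (auto simp: J_def a_def z_def y_def)
    qed
    \<comment> \<open>Built-in relations are never modified, so the invariance found in the initial
      state carries over to \<open>s\<^sub>1\<close>.\<close>
    moreover have "rel_val (state_db s\<^sub>1) q = rel_val (state_db s\<^sub>0) q"
      using q by (auto simp: Qb_def s\<^sub>1_def)
    ultimately show ?thesis by simp
  qed
  have rel_binary: "xs \<in> rel_val (state_db s\<^sub>1) q \<longleftrightarrow> map \<pi> xs \<in> rel_val (state_db s\<^sub>1) q"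
    if q: "q \<in> Qa" and xs: "xs \<in> lists C" for q xs
  proof (cases "length xs \<le> 2")
    case False
    then show ?thesis using long[of q xs \<pi>] arity_Qa[OF q] by linarith
  next
    case True
    show ?thesis
    proof (rule binary_type_invariant[OF hom_z[folded z_def] _ g _ _ _ \<pi>_a \<pi>_z _ True q])
      show "set xs \<subseteq> \<kappa> ` Cs \<union> {a (Y i)} \<union> z ` {..i}" using xs by (auto simp: C_def)
      show "pair_type Qa Cs (\<lambda>q xs. xs \<in> rel_val (state_db s\<^sub>1) q) \<kappa> (a (Y i)) (z k) =
          pair_type Qa Cs (\<lambda>q xs. xs \<in> rel_val (state_db s\<^sub>1) q) \<kappa> (a (Y j)) (z (g k))"
        if "k \<le> i" for k
        using letters[OF that] by (simp add: letter_def)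
    qed (use ij g_n \<pi>_\<kappa> in \<open>auto simp: less_Suc_eq_le\<close>)
  qed
  have iso: "partial_iso (full_schema P) C \<pi> (state_db s\<^sub>1) (state_db s\<^sub>1)"
    unfolding partial_iso_def const_s\<^sub>1 syms Cs_def[symmetric]
  proof (intro conjI ballI)
    fix q xs assume "q \<in> Qa \<union> Qb" "xs \<in> lists C"
    then show "xs \<in> rel_val (state_db s\<^sub>1) q \<longleftrightarrow> map \<pi> xs \<in> rel_val (state_db s\<^sub>1) q"
      using rel_bi rel_binary by blast
  qed (use \<pi>_inj \<pi>_\<kappa> in \<open>simp_all add: C_def\<close>)

  \<comment> \<open>Two corresponding runs with different answers\<close>
  define ms where "ms i' f = (Ins Edge, [s, a (Y i')]) #
      map (\<lambda>e. (Del Edge, e)) (map (\<lambda>k. [z (f k), t]) [0..<Suc i])"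
    for i' and f :: "nat \<Rightarrow> nat"
  have ms_mod: "is_modification st_schema C m" if "m \<in> set (ms i id)" for m
    using that \<kappa>_st
    by (auto simp: ms_def is_modification_def st_schema_def tuples_def C_def simp del: upt_Suc)
  \<comment> \<open>Applying \<open>\<pi>\<close> turns the run that attaches \<open>a (Y i)\<close>
    and cuts off all nodes of \<open>Y i\<close> from \<open>t\<close> into the run that attaches
    \<open>a (Y j)\<close> and cuts off only the nodes \<open>z (g k)\<close> with
    \<open>k \<le> i\<close>.\<close>
  have ms_\<pi>: "map (\<lambda>(\<delta>, e). (\<delta>, map \<pi> e)) (ms i id) = ms j g"
    using \<pi>_a \<pi>_z \<pi>_\<kappa> \<kappa>_st by (simp add: ms_def less_Suc_eq_le del: upt_Suc)
  have ms_D: "\<forall>m \<in> set (ms i id). is_modification st_schema D m"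
    "\<forall>m \<in> set (ms j g). is_modification st_schema D m"
  proof -
    show "\<forall>m \<in> set (ms i id). is_modification st_schema D m"
      using ms_mod C_D(1) by (fastforce simp: is_modification_def tuples_def)
    show "\<forall>m \<in> set (ms j g). is_modification st_schema D m"
      using ms_mod C_D(2) unfolding ms_\<pi>[symmetric]
      by (fastforce simp: is_modification_def tuples_def)
  qed
  have "partial_iso (full_schema P) C \<pi> (state_db (fold (apply_mod P) (ms i id) s\<^sub>1))
      (state_db (fold (apply_mod P) (ms j g) s\<^sub>1))"
    unfolding ms_\<pi>[symmetric]
    by (rule substructure_lemma[OF prog iso])
      (use C_D ms_mod dom st in \<open>auto simp: s\<^sub>1_def\<close>)
  moreover have "Aux (query_sym P) \<in> rel_syms (full_schema P)"
    using prog(1) by (simp add: is_dynamic_program_def full_schema_def union_schema_def)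
  ultimately have same: "[] \<in> rel_val (aux_db (fold (apply_mod P) (ms i id) s\<^sub>1)) (query_sym P)
      \<longleftrightarrow> [] \<in> rel_val (aux_db (fold (apply_mod P) (ms j g) s\<^sub>1)) (query_sym P)"
    unfolding partial_iso_def by (metis lists.Nil list.map(1) state_db_simps(2))
  have answer: "[] \<in> rel_val (aux_db (fold (apply_mod P) (ms i' f) s\<^sub>1)) (query_sym P)
      \<longleftrightarrow> \<not> Y i' \<subseteq> \<iota>\<^sub>2 ` f ` {..i}"
    if "i' \<le> n" "\<And>k. k \<le> i \<Longrightarrow> f k \<le> n" "\<forall>m \<in> set (ms i' f). is_modification st_schema D m" for i' f
  proof -
    let ?I = "fold modify (ms\<^sub>0 @ ms i' f) I\<^sub>0"
    have "st_reachability D ?I = rel_val (aux_db (fold (apply_mod P) (ms i' f) s\<^sub>1)) (query_sym P)"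
      using maint I\<^sub>0 ms\<^sub>0 that(3) st unfolding maintains_def s\<^sub>1_def s\<^sub>0_def
      by (metis (no_types, lifting) Un_iff comp_apply fold_append set_append)
    then have "[] \<in> rel_val (aux_db (fold (apply_mod P) (ms i' f) s\<^sub>1)) (query_sym P)
        \<longleftrightarrow> st_reachable D ?I"
      by (metis boolean_query_def empty_iff insertI1 st_reachability_def)
    moreover have "set (map (\<lambda>k. [z (f k), t]) [0..<Suc i]) = (\<lambda>k. [y k, t]) ` \<iota>\<^sub>2 ` f ` {..i}"
      by (simp add: image_image z_def atLeast0LessThan lessThan_Suc_atMost del: upt_Suc)
    then have "rel_val ?I Edge
        = insert [s, a (Y i')] (fan_edges b t a y) - (\<lambda>k. [y k, t]) ` \<iota>\<^sub>2 ` f ` {..i}"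
      by (simp add: ms_def ms\<^sub>0_def rel_val_fold_insert rel_val_fold_delete I\<^sub>0_def L
          del: upt_Suc map_map)
    moreover have "const_val ?I Source = s" "const_val ?I Target = t"
      by (simp_all only: const_val_fold_modify) (simp_all add: I\<^sub>0_def)
    moreover have "(s, t) \<in> {(u, v). [u, v] \<in> insert [s, a (Y i')] (fan_edges b t a y)
          - (\<lambda>k. [y k, t]) ` \<iota>\<^sub>2 ` f ` {..i}}\<^sup>* \<longleftrightarrow> \<not> Y i' \<subseteq> \<iota>\<^sub>2 ` f ` {..i}"
    proof (rule fan_reachable_iff[OF y_inj a_inj a_y _ _ t(2) Y_sub[OF that(1)]])
      show "a Z \<notin> {s, t}" if "Z \<subseteq> {..<b}" for Z using a_D(2)[OF that] \<kappa>_st by auto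
      show "y k \<notin> {s, t}" if "k < b" for k using y_D(2)[OF that] \<kappa>_st by auto
      show "\<iota>\<^sub>2 ` f ` {..i} \<subseteq> {..<b}" using \<iota>\<^sub>2_less that(2) by auto
    qed
    ultimately show ?thesis by (simp only: st_reachable_def)
  qed
  \<comment> \<open>At most \<open>i + 1\<close> nodes are cut off, while \<open>Y j\<close> has
    \<open>j + 1\<close> elements; so \<open>t\<close> stays reachable in the second run but not in
    the first.\<close>
  have "\<not> Y j \<subseteq> \<iota>\<^sub>2 ` g ` {..i}"
  proof
    assume "Y j \<subseteq> \<iota>\<^sub>2 ` g ` {..i}"
    then have "card (Y j) \<le> card (\<iota>\<^sub>2 ` g ` {..i})" by (intro card_mono) auto
    also have "\<dots> \<le> card {..i}" by (metis card_image_le finite_atMost image_image)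
    also have "card (Y j) = card {..j}"
      unfolding Y_def using \<iota>\<^sub>2_inj ij by (intro card_image) (auto simp: inj_on_def)
    finally show False using ij by simp
  qed
  moreover have "Y i \<subseteq> \<iota>\<^sub>2 ` id ` {..i}" by (simp add: Y_def)
  ultimately show False
    using same answer[OF _ _ ms_D(1)] answer[OF _ _ ms_D(2)] ij g_n by simp
qed

end
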